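(* Let $n\ge2$. For $c\in W_{D_{n+1}^{(2)}}^0=\mathcal C_{2n}^s$, write $\phi_{2n}(c)=(m_0,\dots,m_{n-1},-m_{n-1},\dots,-m_0)$ and set $$c'=\phi_{2n+2}^{-1}(0,m_0,\dots,m_{n-1},0,-m_{n-1},\dots,-m_0).$$ Then the core $c'$ belongs to $\mathcal C_{2n+2}^{dd}$ and there exists $\bar\lambda\in\mathcal C_{2n+2}^{d,r}$ such that $c'=\bar\lambda\bar\lambda$. Moreover, the map which associates to any $c\in\mathcal C_{2n}^s$ the so obtained distinct partition $\bar\lambda\in\mathcal C_{2n+2}^{d,r}$ is a bijection such that $L_{D_{n+1}^{(2)}}(c)=|\bar\lambda|$.
   Context: Partitions and cores. $|\lambda|$ is the number of boxes of a partition $\lambda$. An $N$-core is a partition with no hook length equal to $N$; $\mathcal C_N$ is the set of $N$-cores, $\mathcal C_N^s$ the subset of self-conjugate ones. To a partition $\lambda$ with conjugate $\lambda^{\mathrm{tr}}$ (both extended by zeros) associate the word $\psi(\lambda)=(c_k)_{k\in\mathbb Z}\in\{0,1\}^{\mathbb Z}$ with $c_k=0$ if $k\in\{\lambda_i-i:i\ge1\}$ and $c_k=1$ if $k\in\{j-\lambda_j^{\mathrm{tr}}-1:j\ge1\}$. For an $N$-core $\omega$ with word $(c_k)$, $\phi_N(\omega)=(m_0,\dots,m_{N-1})$ with $m_i=\min\{k\in\mathbb Z: c_{kN+i}=1\}$; $\phi_N$ is a bijection from $\mathcal C_N$ onto $\{m\in\mathbb Z^N:\sum m_i=0\}$, and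 $\omega$ is self-conjugate iff $m_{N-1-i}=-m_i$ for all $i$. Distinct partitions. $\mathcal D$ is the set of partitions with pairwise distinct (positive) parts. For $\bar\lambda=(\bar\lambda_1>\dots>\bar\lambda_\ell)\in\mathcal D$, its shifted Young diagram has boxes $(i,j)$, $1\le i\le\ell$, $i+1\le j\le i+\bar\lambda_i$; the doubled distinct partition $\bar\lambda\bar\lambda$ is the usual partition obtained by adding $\bar\lambda_i$ boxes to the $i$-th column of this shifted diagram, $1\le i\le\ell$. $\mathcal{DD}$ is the set of doubled distinct partitions and $\mathcal C_N^{dd}=\mathcal C_N\cap\mathcal{DD}$. $\mathcal H(\bar\lambda)$ is the multiset of hook lengths of the shifted diagram: the hook length of box $(i,j)$ is the number of boxes strictly to its right, plus the number strictly below it, plus $1$, plus $\bar\lambda_j$ (with $\bar\lambda_j=0$ for $j>\ell$). $\mathcal C_N^{d}$ is the set of $\bar\lambda\in\mathcal D$ with $N\notin\mathcal H(\bar\lambda)$, and $\mathcal C_N^{d,r}$ the subset of those for which $N/2$ is not a part of $\bar\lambda$. Atomic length. The box in row $i$, column $j$ has residue $(j-i)\bmod 2n$. The affine Weyl group $\widetilde{\mathfrak S}_{2n}$ of type $A_{2n-1}^{(1)}$ with simple reflections $s_0,\dots,s_{2n-1}$ acts on $\mathcal C_{2n}$: $s_i\cdot c$ is obtained by removing all removable boxes of residue $i$ if there are some, adding all addable boxes of residue $i$ if there are some, and is $c$ otherwise. With $\alpha_i,\Lambda_i$ the simple roots and fundamental weights of type $A_{2n-1}^{(1)}$, type $D_{n+1}^{(2)}$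 is realized by $\alpha_0^{D}=\alpha_0$, $\alpha_i^{D}=\alpha_i+\alpha_{2n-i}$ ($1\le i\le n-1$), $\alpha_n^{D}=\alpha_n$, $\Lambda_0^D=\Lambda_0$, with Weyl group $W_{D_{n+1}^{(2)}}=\langle s_0,\ s_is_{2n-i}\ (1\le i\le n-1),\ s_n\rangle$; its affine Grassmannian $W_{D_{n+1}^{(2)}}^0$ (minimal length representatives of left cosets modulo the subgroup generated by all generators but $s_0$) is identified with $\mathcal C_{2n}^s$ via $w\mapsto w\cdot\varnothing$. For $c=w\cdot\varnothing$, writing $\Lambda_0^D-w(\Lambda_0^D)=\sum_{i=0}^n a_i^D(c)\alpha_i^D$, one sets $L_{D_{n+1}^{(2)}}(c)=\sum_{i=0}^n a_i^D(c)$. *)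

theory Defs
  imports Main "HOL-Library.Multiset" "HOL-Library.Poly_Mapping"
begin

section \<open>Partitions and cores\<close>

text \<open>
  A partition is the list of its positive parts in weakly decreasing order. Rows, columns and the
  indices of parts start at 1; \<open>part\<close> is the extension by zeros.
\<close>

definition is_partition :: "nat list \<Rightarrow> bool" where
  "is_partition lam \<longleftrightarrow> sorted_wrt (\<ge>) lam \<and> 0 \<notin> set lam"

definition part :: "nat list \<Rightarrow> nat \<Rightarrow> nat" where
  "part lam i = (if 1 \<le> i \<and> i \<le> length lam then lam ! (i - 1) else 0)"

definition boxes :: "nat list \<Rightarrow> (nat \<times> nat) set" where
  "boxes lam = {(i, j). 1 \<le> i \<and> 1 \<le> j \<and> j \<le> part lam i}"

definition is_diagram :: "(nat \<times> nat) set \<Rightarrow> bool" where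
  "is_diagram D \<longleftrightarrow> (\<exists>lam. is_partition lam \<and> boxes lam = D)"

text \<open>Only meaningful on sets of boxes satisfying \<open>is_diagram\<close>.\<close>

definition partition_of :: "(nat \<times> nat) set \<Rightarrow> nat list" where
  "partition_of D = (THE lam. is_partition lam \<and> boxes lam = D)"

definition conjugate :: "nat list \<Rightarrow> nat list" where
  "conjugate lam = map (\<lambda>j. length (filter (\<lambda>p. j \<le> p) lam)) [1..<Suc (part lam 1)]"

definition hook :: "nat list \<Rightarrow> nat \<times> nat \<Rightarrow> nat" where
  "hook lam = (\<lambda>(i, j). card {j'. j < j' \<and> (i, j') \<in> boxes lam}
                       + card {i'. i < i' \<and> (i', j) \<in> boxes lam} + 1)"

definition cores :: "nat \<Rightarrow> nat list set" where
  "cores N = {lam. is_partition lam \<and> (\<forall>b\<in>boxes lam. hook lam b \<noteq> N)}"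

definition sc_cores :: "nat \<Rightarrow> nat list set" where
  "sc_cores N = {lam \<in> cores N. conjugate lam = lam}"

text \<open>
  The positions of the letter 1 are defined here as the complement of those of the letter 0; the
  lemma \<open>word_eq_1_iff\<close> below gives their description by the conjugate partition.
\<close>

definition word :: "nat list \<Rightarrow> int \<Rightarrow> nat" where
  "word lam k = (if k \<in> {int (part lam i) - int i | i. 1 \<le> i} then 0 else 1)"

text \<open>The vector \<open>(m\<^sub>0, \<dots>, m\<^sub>N\<^sub>-\<^sub>1)\<close> is a list of length \<open>N\<close>, indexed from 0.\<close>

definition phi :: "nat \<Rightarrow> nat list \<Rightarrow> int list" where
  "phi N lam = map (\<lambda>i. LEAST k::int. word lam (k * int N + int i) = 1) [0..<N]"

definition phi_inv :: "nat \<Rightarrow> int list \<Rightarrow> nat list" where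
  "phi_inv N = inv_into (cores N) (phi N)"

lemma part_conjugate:
  assumes "is_partition lam" "1 \<le> j"
  shows "part (conjugate lam) j = length (filter (\<lambda>p. j \<le> p) lam)"
proof (cases "j \<le> part lam 1")
  case True
  define m where "m = part lam 1"
  have "part (map f [1..<Suc m]) j = f j" if "j \<le> m" for f :: "nat \<Rightarrow> nat"
    using that assms(2) by (simp add: part_def del: upt_Suc)
  then show ?thesis using True by (simp add: conjugate_def m_def)
next
  case False
  have "p < j" if p: "p \<in> set lam" for p
  proof -
    obtain a l where l: "lam = a # l" using p by (cases lam) auto
    have "p \<le> a" using assms(1) p l by (auto simp: is_partition_def)
    moreover have "part lam 1 = a" by (simp add: part_def l)
    ultimately show ?thesis using False by simp
  qed
  then have "filter (\<lambda>p. j \<le> p) lam = []" by (auto simp: filter_empty_conv not_le)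
  then show ?thesis using False by (simp add: part_def conjugate_def del: upt_Suc)
qed

lemma le_part_iff:
  assumes "is_partition lam" "1 \<le> i" "1 \<le> j"
  shows "j \<le> part lam i \<longleftrightarrow> i \<le> part (conjugate lam) j"
proof -
  have "sorted_wrt (\<ge>) lam \<Longrightarrow> j \<le> part lam i \<longleftrightarrow> i \<le> length (filter (\<lambda>p. j \<le> p) lam)"
    using assms(2)
  proof (induction lam arbitrary: i)
    case Nil
    then show ?case using assms(3) by (simp add: part_def)
  next
    case (Cons a l)
    show ?case
    proof (cases "i = 1")
      case True
      have "filter (\<lambda>p. j \<le> p) l = []" if "a < j"
        using that Cons.prems by (auto simp: filter_empty_conv)
      then show ?thesis using True by (auto simp: part_def Suc_le_eq not_le)
    next
      case False
      then obtain i' where i': "i = Suc i'" "1 \<le> i'" using Cons.prems by (cases i) auto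
      have part: "part (a # l) i = part l i'" using i' by (auto simp: part_def nth_Cons split: nat.split)
      have IH: "j \<le> part l i' \<longleftrightarrow> i' \<le> length (filter (\<lambda>p. j \<le> p) l)"
        using Cons i' by simp
      have "filter (\<lambda>p. j \<le> p) l = []" if "a < j"
        using that Cons.prems by (auto simp: filter_empty_conv)
      then show ?thesis using i' part IH by (cases "j \<le> a") (auto simp: not_le)
    qed
  qed
  then show ?thesis using assms by (simp add: part_conjugate is_partition_def)
qed

lemma word_eq_1_iff:
  assumes "is_partition lam"
  shows "word lam k = 1 \<longleftrightarrow> k \<in> {int j - int (part (conjugate lam) j) - 1 | j. 1 \<le> j}"
proof
  assume "word lam k = 1"
  then have ne: "k \<noteq> int (part lam i) - int i" if "1 \<le> i" for i
    using that unfolding word_def by (metis (mono_tags, lifting) mem_Collect_eq zero_neq_one)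
  define P where "P i \<longleftrightarrow> 1 \<le> i \<and> int (part lam i) - int i \<le> k" for i
  have "P (Suc (length lam + nat (- k)))" unfolding P_def part_def by simp
  then have PL: "P (LEAST i. P i)" by (rule LeastI)
  define i where "i = (LEAST i. P i)"
  have Pi: "P i" using PL i_def by simp
  have i1: "1 \<le> i" and lt: "int (part lam i) - int i < k"
    using Pi ne[of i] unfolding P_def by linarith+
  define j where "j = nat (k + int i)"
  have j: "int j = k + int i" "1 \<le> j" using lt unfolding j_def by linarith+
  have "\<not> i \<le> part (conjugate lam) j"
    using le_part_iff[OF assms i1 j(2)] lt j by linarith
  moreover have "i - 1 \<le> part (conjugate lam) j"
  proof (cases "i = 1")
    case False
    have "\<not> P (i - 1)" using i1 unfolding i_def by (intro not_less_Least) simp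
    then have "int (part lam (i - 1)) - int (i - 1) > k" using False i1 unfolding P_def by linarith
    then have "j \<le> part lam (i - 1)" using i1 j(1) by linarith
    then show ?thesis using le_part_iff[OF assms _ j(2), of "i - 1"] False i1 by simp
  qed simp
  ultimately have "int (part (conjugate lam) j) = int i - 1" using i1 by linarith
  then show "k \<in> {int j - int (part (conjugate lam) j) - 1 | j. 1 \<le> j}"
    using j by (intro CollectI exI[of _ j]) linarith
next
  assume "k \<in> {int j - int (part (conjugate lam) j) - 1 | j. 1 \<le> j}"
  then obtain j where j: "1 \<le> j" "k = int j - int (part (conjugate lam) j) - 1" by blast
  have "k \<noteq> int (part lam i) - int i" if "1 \<le> i" for i
    using le_part_iff[OF assms that j(1)] j by linarith
  then have "k \<notin> {int (part lam i) - int i | i. 1 \<le> i}" by blast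
  then show "word lam k = 1" unfolding word_def by (rule if_not_P)
qed


section \<open>Distinct partitions\<close>

definition distinct_partitions :: "nat list set" where
  "distinct_partitions = {lam. sorted_wrt (>) lam \<and> 0 \<notin> set lam}"

definition shifted_boxes :: "nat list \<Rightarrow> (nat \<times> nat) set" where
  "shifted_boxes lam = {(i, j). 1 \<le> i \<and> i \<le> length lam \<and> i + 1 \<le> j \<and> j \<le> i + part lam i}"

text \<open>
  For a distinct partition every column of the shifted diagram is an initial segment of rows, so the
  partition is given by the column heights after adding \<open>part lam j\<close> boxes to column \<open>j\<close>.
\<close>

definition doubled :: "nat list \<Rightarrow> nat list" where
  "doubled lam = partition_of
     {(i, j). 1 \<le> i \<and> 1 \<le> j \<and> i \<le> card {i'. (i', j) \<in> shifted_boxes lam} + part lam j}"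

definition dd_cores :: "nat \<Rightarrow> nat list set" where
  "dd_cores N = cores N \<inter> doubled ` distinct_partitions"

definition shifted_hook :: "nat list \<Rightarrow> nat \<times> nat \<Rightarrow> nat" where
  "shifted_hook lam = (\<lambda>(i, j). card {j'. j < j' \<and> (i, j') \<in> shifted_boxes lam}
                               + card {i'. i < i' \<and> (i', j) \<in> shifted_boxes lam}
                               + 1 + part lam j)"

definition shifted_hooks :: "nat list \<Rightarrow> nat multiset" where
  "shifted_hooks lam = image_mset (shifted_hook lam) (mset_set (shifted_boxes lam))"

definition d_cores :: "nat \<Rightarrow> nat list set" where
  "d_cores N = {lam \<in> distinct_partitions. N \<notin># shifted_hooks lam}"

definition dr_cores :: "nat \<Rightarrow> nat list set" where
  "dr_cores N = {lam \<in> d_cores N. \<forall>p\<in>set lam. 2 * p \<noteq> N}"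


section \<open>The affine Weyl group of type A and its action on cores\<close>

text \<open>
  Weights of type \<open>A\<^sub>N\<^sub>-\<^sub>1\<close> affine are taken in the lattice with basis the fundamental weight \<open>Lam0\<close>
  and the simple roots \<open>Alpha j\<close> for \<open>j < N\<close>. This lattice spans the dual of the Cartan subalgebra
  and is stable under the Weyl group. The Cartan matrix below is the one for \<open>N \<ge> 3\<close>.
\<close>

datatype wt_basis = Lam0 | Alpha nat

type_synonym weight = "wt_basis \<Rightarrow>\<^sub>0 int"

definition cartan_A :: "nat \<Rightarrow> nat \<Rightarrow> nat \<Rightarrow> int" where
  "cartan_A N i j = (if i = j then 2
                     else if j = (i + 1) mod N \<or> i = (j + 1) mod N then - 1 else 0)"

text \<open>The value of a weight at the simple coroot of index \<open>i\<close>.\<close>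

definition coroot_A :: "nat \<Rightarrow> nat \<Rightarrow> weight \<Rightarrow> int" where
  "coroot_A N i v = (if i = 0 then Poly_Mapping.lookup v Lam0 else 0)
                    + (\<Sum>j<N. cartan_A N i j * Poly_Mapping.lookup v (Alpha j))"

definition refl_A :: "nat \<Rightarrow> nat \<Rightarrow> weight \<Rightarrow> weight" where
  "refl_A N i v = v - frag_cmul (coroot_A N i v) (frag_of (Alpha i))"

definition residue :: "nat \<Rightarrow> nat \<times> nat \<Rightarrow> int" where
  "residue N = (\<lambda>(i, j). (int j - int i) mod int N)"

definition addable :: "nat \<Rightarrow> nat \<Rightarrow> nat list \<Rightarrow> (nat \<times> nat) set" where
  "addable N r c = {b. b \<notin> boxes c \<and> is_diagram (insert b (boxes c)) \<and> residue N b = int r}"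

definition removable :: "nat \<Rightarrow> nat \<Rightarrow> nat list \<Rightarrow> (nat \<times> nat) set" where
  "removable N r c = {b. b \<in> boxes c \<and> is_diagram (boxes c - {b}) \<and> residue N b = int r}"

definition core_refl :: "nat \<Rightarrow> nat \<Rightarrow> nat list \<Rightarrow> nat list" where
  "core_refl N r c = (if removable N r c \<noteq> {} then partition_of (boxes c - removable N r c)
                      else if addable N r c \<noteq> {} then partition_of (boxes c \<union> addable N r c)
                      else c)"

text \<open>
  \<open>core_act N w c d\<close> means \<open>w \<cdot> c = d\<close>. It is the graph of the action of the Weyl group, a group of
  automorphisms of the weight lattice, that extends \<open>core_refl\<close> from the simple reflections.
\<close>

inductive core_act :: "nat \<Rightarrow> (weight \<Rightarrow> weight) \<Rightarrow> nat list \<Rightarrow> nat list \<Rightarrow> bool" for N where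
  core_act_id: "core_act N id c c"
| core_act_refl: "core_act N w c d \<Longrightarrow> r < N \<Longrightarrow> core_act N (refl_A N r \<circ> w) c (core_refl N r d)"


section \<open>Type D and the atomic length\<close>

text \<open>
  Type \<open>D\<close> of rank \<open>n + 1\<close> (twisted) inside type \<open>A\<close> with \<open>N = 2 * n\<close>. The generators are
  involutions, so the products of words in them already form the generated group.
\<close>

definition alpha_D :: "nat \<Rightarrow> nat \<Rightarrow> weight" where
  "alpha_D n i = (if i = 0 \<or> i = n then frag_of (Alpha i)
                  else frag_of (Alpha i) + frag_of (Alpha (2 * n - i)))"

definition gen_D :: "nat \<Rightarrow> nat \<Rightarrow> weight \<Rightarrow> weight" where
  "gen_D n i = (if i = 0 \<or> i = n then refl_A (2 * n) i
                else refl_A (2 * n) i \<circ> refl_A (2 * n) (2 * n - i))"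

definition word_prod_D :: "nat \<Rightarrow> nat list \<Rightarrow> weight \<Rightarrow> weight" where
  "word_prod_D n ws = foldr (\<lambda>i f. gen_D n i \<circ> f) ws id"

definition W_D :: "nat \<Rightarrow> (weight \<Rightarrow> weight) set" where
  "W_D n = word_prod_D n ` lists {0..n}"

definition W_D_fin :: "nat \<Rightarrow> (weight \<Rightarrow> weight) set" where
  "W_D_fin n = word_prod_D n ` lists {1..n}"

definition length_D :: "nat \<Rightarrow> (weight \<Rightarrow> weight) \<Rightarrow> nat" where
  "length_D n w = (LEAST k. \<exists>ws\<in>lists {0..n}. length ws = k \<and> word_prod_D n ws = w)"

definition grassmannian_D :: "nat \<Rightarrow> (weight \<Rightarrow> weight) set" where
  "grassmannian_D n = {w \<in> W_D n. \<forall>u\<in>W_D_fin n. length_D n w \<le> length_D n (w \<circ> u)}"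

definition L_D :: "nat \<Rightarrow> nat list \<Rightarrow> int" where
  "L_D n c = (THE l. \<exists>w\<in>grassmannian_D n. \<exists>a :: nat \<Rightarrow> int.
      core_act (2 * n) w [] c
      \<and> frag_of Lam0 - w (frag_of Lam0) = (\<Sum>i\<le>n. frag_cmul (a i) (alpha_D n i))
      \<and> l = (\<Sum>i\<le>n. a i))"


section \<open>From self-conjugate cores to distinct partitions\<close>

definition lift_core :: "nat \<Rightarrow> nat list \<Rightarrow> nat list" where
  "lift_core n c = (let m = take n (phi (2 * n) c)
                    in phi_inv (2 * n + 2) ([0] @ m @ [0] @ rev (map uminus m)))"

definition distinct_of_core :: "nat \<Rightarrow> nat list \<Rightarrow> nat list" where
  "distinct_of_core n c = (THE lam. lam \<in> dr_cores (2 * n + 2) \<and> lift_core n c = doubled lam)"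

end

theory Submission
  imports Defs
begin

text \<open>
  All partitions are studied through their words, or equivalently their sets of beads: the positions
  \<open>part lam i - i\<close> of the letter 0. In these terms a partition is an \<open>N\<close>-core if moving any bead by \<open>N\<close>
  to the left leads to a bead again (\<open>cores_iff\<close>), it is self-conjugate if exactly one of \<open>k\<close> and
  \<open>- 1 - k\<close> is a bead for all \<open>k\<close> (\<open>conjugate_eq_iff\<close>), and the doubled partition of a distinct
  partition is described by a word that is symmetric about the gap 0 and whose positive beads are the parts
  (\<open>beta_doubled\<close>). The hook lengths of a shifted diagram are those of the corresponding boxes of the
  doubled diagram, and by symmetry \<open>lam\<close> belongs to \<open>dr_cores N\<close> exactly if its doubled partition is an
  \<open>N\<close>-core (\<open>dr_cores_iff\<close>).

  The passage from \<open>c\<close> to the larger core inserts two runners into the abacus, which moves the position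
  \<open>s\<close> to \<open>s + 1 + s div n\<close>. This is the order isomorphism from the integers onto the integers that are not
  multiples of \<open>n + 1\<close>; it takes \<open>- 1 - s\<close> to the negative of the image of \<open>s\<close>, and steps of \<open>2 * n\<close> to
  steps of \<open>2 * n + 2\<close>. So it carries self-conjugate \<open>2 * n\<close>-cores to doubled distinct
  \<open>(2 * n + 2)\<close>-cores, and the parts of the distinct partition are the numbers \<open>s + 1 + s div n\<close> for the
  nonnegative beads \<open>s\<close> of \<open>c\<close> (\<open>lift_core_eq\<close>). Since no part can be a multiple of \<open>n + 1\<close>
  (\<open>dr_core_no_multiple\<close>), all distinct partitions in question arise in this way (\<open>stretched_surj\<close>).

  For the atomic length, a simple reflection changes the number of boxes of its residue in a core by the value
  of the simple coroot at the weight of the core (\<open>residue_count_core_refl\<close>). Therefore, if \<open>w\<close> takes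
  the empty core to \<open>c\<close>, the coefficients of \<open>Lam0 - w Lam0\<close> count the boxes of \<open>c\<close> by residue
  (\<open>core_act_weight\<close>), and the atomic length is the number of boxes with residue \<open>0, \<dots>, n\<close>
  (\<open>L_D_eq\<close>). Such a \<open>w\<close> exists because a nonempty self-conjugate core always has corners that a generator
  of the group of type \<open>D\<close> removes (\<open>act_D_decreases\<close>). Counting the boxes with residue \<open>0, \<dots>, n\<close> by
  diagonals, the nonnegative bead \<open>s\<close> contributes \<open>s + 1 + s div n\<close> (\<open>sum_residue_counts\<close>), which is the
  corresponding part of the distinct partition.
\<close>

section \<open>Partitions and diagrams\<close>

lemma part_antimono:
  assumes "is_partition lam" "1 \<le> i" "i \<le> i'"
  shows "part lam i' \<le> part lam i"
proof (cases "i' \<le> length lam")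
  case True
  have "sorted_wrt (\<ge>) lam" using assms(1) by (simp add: is_partition_def)
  then have "i - 1 < i' - 1 \<Longrightarrow> lam ! (i' - 1) \<le> lam ! (i - 1)"
    using True assms sorted_wrt_nth_less by (metis Suc_pred' diff_less less_le_trans less_one not_le zero_less_Suc)
  then show ?thesis using assms True by (cases "i = i'") (auto simp: part_def)
qed (simp add: part_def)

lemma finite_boxes: "finite (boxes lam)"
proof (rule finite_subset)
  show "boxes lam \<subseteq> Sigma {1..length lam} (\<lambda>i. {1..part lam i})"
    by (auto simp: boxes_def part_def split: if_splits)
qed simp

text \<open>Row lengths are compared through the boxes that they contain.\<close>

lemma nat_eqI_pos:
  fixes a b :: nat
  assumes "\<And>j. 1 \<le> j \<Longrightarrow> j \<le> a \<longleftrightarrow> j \<le> b"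
  shows "a = b"
proof (rule antisym)
  show "a \<le> b" using assms[of a] by (cases "a = 0") simp_all
  show "b \<le> a" using assms[of b] by (cases "b = 0") simp_all
qed

lemma partition_eqI:
  assumes "is_partition lam" "is_partition mu" "\<And>i. 1 \<le> i \<Longrightarrow> part lam i = part mu i"
  shows "lam = mu"
proof -
  have pos: "i \<le> length l \<longleftrightarrow> 0 < part l i" if "is_partition l" "1 \<le> i" for l i
  proof (cases "i \<le> length l")
    case True
    then have "l ! (i - 1) \<in> set l" using that(2) by (intro nth_mem) linarith
    then have "l ! (i - 1) \<noteq> 0" using that(1) unfolding is_partition_def by metis
    then show ?thesis using True that(2) by (simp add: part_def)
  qed (simp add: part_def)
  have len: "length lam = length mu"
  proof (rule nat_eqI_pos)
    fix i :: nat assume "1 \<le> i"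
    then show "i \<le> length lam \<longleftrightarrow> i \<le> length mu"
      using pos[OF assms(1)] pos[OF assms(2)] assms(3) by simp
  qed
  show ?thesis
  proof (rule nth_equalityI[OF len])
    fix i assume "i < length lam"
    then show "lam ! i = mu ! i" using assms(3)[of "Suc i"] len by (simp add: part_def)
  qed
qed

lemma boxes_inj:
  assumes "is_partition lam" "is_partition mu" "boxes lam = boxes mu"
  shows "lam = mu"
proof (rule partition_eqI[OF assms(1,2)])
  fix i :: nat assume i: "1 \<le> i"
  show "part lam i = part mu i"
  proof (rule nat_eqI_pos)
    fix j :: nat assume "1 \<le> j"
    then show "j \<le> part lam i \<longleftrightarrow> j \<le> part mu i"
      using eqset_imp_iff[OF assms(3), of "(i, j)"] i by (simp add: boxes_def)
  qed
qed

lemma partition_of_boxes: "is_partition lam \<Longrightarrow> partition_of (boxes lam) = lam"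
  unfolding partition_of_def by (rule the_equality) (auto intro: boxes_inj)

lemma partition_of_diagram:
  assumes "is_diagram D"
  shows "is_partition (partition_of D)" "boxes (partition_of D) = D"
  using assms partition_of_boxes by (auto simp: is_diagram_def)

lemma initial_segment:
  assumes "finite A" "\<And>i. i \<in> A \<Longrightarrow> 1 \<le> i" "\<And>i i'. i \<in> A \<Longrightarrow> 1 \<le> i' \<Longrightarrow> i' \<le> i \<Longrightarrow> i' \<in> A"
  shows "A = {1..card A}"
proof (cases "A = {}")
  case False
  have "Max A \<in> A" using assms(1) False by (rule Max_in)
  then have "{1..Max A} \<subseteq> A" using assms(3) by auto
  moreover have "A \<subseteq> {1..Max A}" using assms(1,2) by auto
  ultimately have "A = {1..Max A}" by (rule subset_antisym[rotated])
  then show ?thesis by (metis card_atLeastAtMost diff_Suc_1)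
qed simp

text \<open>
  Diagrams are the finite order ideals of the positive quadrant. In this form it is obvious that
  any set of corners may be removed at once, and any set of addable boxes added at once.
\<close>

lemma is_diagram_iff:
  "is_diagram D \<longleftrightarrow> finite D \<and> (\<forall>i j. (i, j) \<in> D \<longrightarrow> 1 \<le> i \<and> 1 \<le> j)
     \<and> (\<forall>i j. (Suc i, j) \<in> D \<longrightarrow> 1 \<le> i \<longrightarrow> (i, j) \<in> D)
     \<and> (\<forall>i j. (i, Suc j) \<in> D \<longrightarrow> 1 \<le> j \<longrightarrow> (i, j) \<in> D)"
  (is "_ \<longleftrightarrow> ?R")
proof
  assume "is_diagram D"
  then obtain lam where lam: "is_partition lam" "D = boxes lam" by (auto simp: is_diagram_def)
  have "part lam (Suc i) \<le> part lam i" if "1 \<le> i" for i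
    using part_antimono[OF lam(1) that] by simp
  then show ?R using finite_boxes[of lam] unfolding lam(2)
    by (auto simp: boxes_def dest: order_trans)
next
  assume R: ?R
  then have fin: "finite D"
    and pos1: "\<And>i j. (i, j) \<in> D \<Longrightarrow> 1 \<le> i \<and> 1 \<le> j"
    and up1: "\<And>i j. (Suc i, j) \<in> D \<Longrightarrow> 1 \<le> i \<Longrightarrow> (i, j) \<in> D"
    and left1: "\<And>i j. (i, Suc j) \<in> D \<Longrightarrow> 1 \<le> j \<Longrightarrow> (i, j) \<in> D"
    by blast+
  have up: "(i, j) \<in> D" if "(i', j) \<in> D" "1 \<le> i" "i \<le> i'" for i i' j
    using that(3,1,2)
  proof (induction rule: inc_induct)
    case (step m)
    then show ?case using up1[of m j] by simp
  qed
  have left: "(i, j) \<in> D" if "(i, j') \<in> D" "1 \<le> j" "j \<le> j'" for i j j'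
    using that(3,1,2)
  proof (induction rule: inc_induct)
    case (step m)
    then show ?case using left1[of i m] by simp
  qed
  define row where "row i = card {j. (i, j) \<in> D}" for i
  have row: "{j. (i, j) \<in> D} = {1..row i}" for i unfolding row_def
  proof (rule initial_segment)
    have "{j. (i, j) \<in> D} \<subseteq> snd ` D" by force
    then show "finite {j. (i, j) \<in> D}" using fin finite_subset by blast
  qed (use pos1 left in blast)+
  have mem: "(i, j) \<in> D \<longleftrightarrow> 1 \<le> j \<and> j \<le> row i" for i j
    using eqset_imp_iff[OF row, of j i] by simp
  define l where "l = card {i. (i, 1) \<in> D}"
  have col: "{i. (i, 1) \<in> D} = {1..l}" unfolding l_def
  proof (rule initial_segment)
    have "{i. (i, 1) \<in> D} \<subseteq> fst ` D" by force
    then show "finite {i. (i, 1) \<in> D}" using fin finite_subset by blast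
  qed (use pos1 up in blast)+
  define lam where "lam = map row [1..<Suc l]"
  have pos: "0 < row i \<longleftrightarrow> 1 \<le> i \<and> i \<le> l" for i
  proof -
    have "(i, 1) \<in> D \<longleftrightarrow> 1 \<le> i \<and> i \<le> l" using eqset_imp_iff[OF col, of i] by simp
    then show ?thesis using mem[of i 1] by linarith
  qed
  have part: "part lam i = row i" if "1 \<le> i" for i
  proof (cases "i \<le> l")
    case True
    then show ?thesis using that by (simp add: part_def lam_def del: upt_Suc)
  next
    case False
    then show ?thesis using pos[of i] by (simp add: part_def lam_def del: upt_Suc)
  qed
  have anti: "row i' \<le> row i" if "1 \<le> i" "i \<le> i'" for i i'
  proof (cases "row i' = 0")
    case False
    then have "(i', row i') \<in> D" using mem[of i' "row i'"] by simp
    then have "(i, row i') \<in> D" using up that by blast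
    then show ?thesis using mem[of i "row i'"] by simp
  qed simp
  have "is_partition lam" unfolding is_partition_def lam_def
  proof
    show "sorted_wrt (\<ge>) (map row [1..<Suc l])"
      using anti by (auto simp: sorted_wrt_iff_nth_less simp del: upt_Suc)
    show "0 \<notin> set (map row [1..<Suc l])" 
    proof
      assume "0 \<in> set (map row [1..<Suc l])"
      then obtain i where "1 \<le> i" "i \<le> l" "row i = 0" by (auto simp del: upt_Suc)
      then show False using pos[of i] by simp
    qed
  qed
  moreover have "boxes lam = D"
    
  proof (intro set_eqI, clarify)
    fix i j show "(i, j) \<in> boxes lam \<longleftrightarrow> (i, j) \<in> D"
      using part[of i] mem[of i j] pos1[of i j] by (auto simp: boxes_def)
  qed
  ultimately show "is_diagram D" by (auto simp: is_diagram_def)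
qed

lemma is_diagram_boxes: "is_partition lam \<Longrightarrow> is_diagram (boxes lam)"
  by (auto simp: is_diagram_def)

lemma is_partition_conjugate:
  assumes "is_partition lam"
  shows "is_partition (conjugate lam)"
proof -
  have len: "length (filter (\<lambda>p. j' \<le> p) l) \<le> length (filter (\<lambda>p. j \<le> p) l)"
    if "j \<le> j'" for j j' and l :: "nat list"
    using that by (induction l) auto
  have pos: "filter (\<lambda>p. j \<le> p) lam \<noteq> []" if "1 \<le> j" "j \<le> part lam 1" for j
    using that by (cases lam) (auto simp: part_def filter_empty_conv)
  show ?thesis unfolding is_partition_def conjugate_def
    using len pos by (auto simp: sorted_wrt_iff_nth_less simp del: upt_Suc)
qed

section \<open>Beta-sets\<close>

text \<open>The set of positions of the letter 0 in the word of the partition. Its elements are called beads, the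
  other positions gaps.\<close>

definition beta :: "nat list \<Rightarrow> int set" where
  "beta lam = {int (part lam i) - int i | i. 1 \<le> i}"

lemma word_eq_1_beta: "word lam k = 1 \<longleftrightarrow> k \<notin> beta lam"
  by (simp add: word_def beta_def)

text \<open>Since the numbers \<open>part lam i - i\<close> decrease strictly with \<open>i\<close>, this is the number of beads at or to
  the right of \<open>k\<close>. Counting rows in place of beads gives direct access to the diagram: the rows
  counted are the first ones, and box \<open>(i, j)\<close> exists exactly if row \<open>i\<close> is counted for \<open>k = j - i\<close>.\<close>

definition above :: "nat list \<Rightarrow> int \<Rightarrow> nat" where
  "above lam k = card {i. 1 \<le> i \<and> k \<le> int (part lam i) - int i}"

lemma rows_above:
  assumes "is_partition lam"
  shows "{i. 1 \<le> i \<and> k \<le> int (part lam i) - int i} = {1..above lam k}"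
  unfolding above_def
proof (rule initial_segment)
  have "i \<le> nat (int (part lam 1) - k)" if "1 \<le> i" "k \<le> int (part lam i) - int i" for i
    using part_antimono[OF assms _ that(1)] that by simp
  then show "finite {i. 1 \<le> i \<and> k \<le> int (part lam i) - int i}"
    by (auto intro!: finite_subset[OF _ finite_atMost[of "nat (int (part lam 1) - k)"]])
  fix i i' assume "i \<in> {i. 1 \<le> i \<and> k \<le> int (part lam i) - int i}" "1 \<le> i'" "i' \<le> i"
  then show "i' \<in> {i. 1 \<le> i \<and> k \<le> int (part lam i) - int i}"
    using part_antimono[OF assms, of i' i] by simp
qed auto

lemma le_above_iff:
  assumes "is_partition lam" "1 \<le> i"
  shows "i \<le> above lam k \<longleftrightarrow> k \<le> int (part lam i) - int i"
  using eqset_imp_iff[OF rows_above[OF assms(1), of k], of i] assms(2) by simp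

lemma mem_boxes_above:
  assumes "is_partition lam"
  shows "(i, j) \<in> boxes lam \<longleftrightarrow> 1 \<le> i \<and> 1 \<le> j \<and> i \<le> above lam (int j - int i)"
  using le_above_iff[OF assms, of i "int j - int i"] by (auto simp: boxes_def)

text \<open>At most one row is lost between \<open>k\<close> and \<open>k + 1\<close>, namely the row whose bead is \<open>k\<close>.\<close>

lemma above_step:
  assumes "is_partition lam"
  shows "int (above lam k) = int (above lam (k + 1)) + of_bool (k \<in> beta lam)"
proof -
  note le = le_above_iff[OF assms]
  have A: "above lam (k + 1) \<le> above lam k"
    using le[of "above lam (k + 1)" "k + 1"] le[of "above lam (k + 1)" k]
    by (cases "above lam (k + 1) = 0") simp_all
  have B: "i = above lam k \<and> i = Suc (above lam (k + 1))" 
    if "1 \<le> i" "k = int (part lam i) - int i" for i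
  proof -
    have "int (part lam (Suc i)) - int (Suc i) < k"
      using part_antimono[OF assms that(1), of "Suc i"] that(2) by simp
    then have "\<not> Suc i \<le> above lam k" using le[of "Suc i" k] by simp
    moreover have "i \<le> above lam k" "\<not> i \<le> above lam (k + 1)" using le[of i] that by auto
    moreover have "i - 1 \<le> above lam (k + 1)"
    proof (cases "i = 1")
      case False
      then show ?thesis using le[of "i - 1" "k + 1"] part_antimono[OF assms, of "i - 1" i] that
        by auto
    qed simp
    ultimately show ?thesis by linarith
  qed
  show ?thesis
  proof (cases "k \<in> beta lam")
    case True
    then show ?thesis using B unfolding beta_def by fastforce
  next
    case False
    have "above lam k \<le> above lam (k + 1)"
    proof (cases "above lam k = 0")
      case nz: False
      have "k \<noteq> int (part lam (above lam k)) - int (above lam k)"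
        using False nz unfolding beta_def by force
      moreover have "k \<le> int (part lam (above lam k)) - int (above lam k)"
        using le[of "above lam k" k] nz by simp
      ultimately show ?thesis using le[of "above lam k" "k + 1"] nz by simp
    qed simp
    then show ?thesis using A False by simp
  qed
qed

lemma above_ge: 
  assumes "is_partition lam"
  shows "- k \<le> int (above lam k)"
  using le_above_iff[OF assms, of "nat (- k)" k] by (cases "k < 0") (simp_all, linarith)

lemma above_eq_0: 
  assumes "is_partition lam" "int (part lam 1) \<le> k"
  shows "above lam k = 0"
  using le_above_iff[OF assms(1), of 1 k] assms(2) by (cases "above lam k") auto

text \<open>Far to the right there are no beads. From there on, \<open>above\<close> is found step by step to the left from
  the beads alone, and it determines the diagram.\<close>

lemma beta_inj:
  assumes "is_partition lam" "is_partition mu" "beta lam = beta mu"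
  shows "lam = mu"
proof (rule boxes_inj[OF assms(1,2)])
  have eq: "above lam k = above mu k" for k
  proof -
    define K where "K = max k (int (max (part lam 1) (part mu 1)))"
    have "k \<le> K" by (simp add: K_def)
    then show ?thesis
    proof (induction rule: int_le_induct)
      case base
      then show ?case using above_eq_0[OF assms(1)] above_eq_0[OF assms(2)] by (simp add: K_def)
    next
      case (step i)
      then show ?case
        using above_step[OF assms(1), of "i - 1"] above_step[OF assms(2), of "i - 1"] assms(3) by simp
    qed
  qed
  then show "boxes lam = boxes mu"
    using mem_boxes_above[OF assms(1)] mem_boxes_above[OF assms(2)] by (auto simp: set_eq_iff)
qed

lemma beta_bounds:
  assumes "is_partition lam"
  shows "k \<in> beta lam \<Longrightarrow> k < int (part lam 1)" "k < - int (length lam) \<Longrightarrow> k \<in> beta lam"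
proof -
  show "k < int (part lam 1)" if k: "k \<in> beta lam"
  proof -
    obtain i where "1 \<le> i" "k = int (part lam i) - int i" using k by (auto simp: beta_def)
    then show ?thesis using part_antimono[OF assms, of 1 i] by simp
  qed
  show "k \<in> beta lam" if "k < - int (length lam)"
    using that unfolding beta_def by (intro CollectI exI[of _ "nat (- k)"]) (auto simp: part_def)
qed

lemma beta_conjugate:
  assumes "is_partition lam"
  shows "k \<in> beta (conjugate lam) \<longleftrightarrow> - 1 - k \<notin> beta lam"
proof -
  have "(\<exists>j. k = int (part (conjugate lam) j) - int j \<and> 1 \<le> j) \<longleftrightarrow>
        (\<exists>j. - 1 - k = int j - int (part (conjugate lam) j) - 1 \<and> 1 \<le> j)"
    by (intro arg_cong[of _ _ Ex] ext) auto
  then show ?thesis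
    using word_eq_1_iff[OF assms, of "- 1 - k"] word_eq_1_beta[of lam "- 1 - k"]
    by (simp add: beta_def)
qed

lemma conjugate_eq_iff:
  assumes "is_partition lam"
  shows "conjugate lam = lam \<longleftrightarrow> (\<forall>k. k \<in> beta lam \<longleftrightarrow> - 1 - k \<notin> beta lam)"
  using beta_conjugate[OF assms] beta_inj[OF is_partition_conjugate[OF assms] assms]
  by (metis set_eqI)

definition diag :: "nat list \<Rightarrow> int \<Rightarrow> nat" where
  "diag lam k = card {b \<in> boxes lam. int (snd b) - int (fst b) = k}"

lemma diag_above:
  assumes "is_partition lam"
  shows "int (diag lam k) = int (above lam k) - max 0 (- k)"
proof -
  have "{b \<in> boxes lam. int (snd b) - int (fst b) = k}
        = (\<lambda>i. (i, nat (int i + k))) ` {Suc (nat (- k))..above lam k}"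
    using mem_boxes_above[OF assms] by (auto simp: image_iff)
  then have "diag lam k = card {Suc (nat (- k))..above lam k}"
    unfolding diag_def by (simp add: card_image inj_on_def)
  then show ?thesis using above_ge[OF assms, of k] by auto
qed

text \<open>The bead of row \<open>i\<close> and the diagonal through the last box of row \<open>i\<close> have the same index. The second
  term on the right accounts for the diagonals below the main one, which start in column 1 and
  therefore in lower and lower rows.\<close>

lemma diag_step:
  assumes "is_partition lam"
  shows "int (diag lam k) - int (diag lam (k + 1)) = of_bool (k \<in> beta lam) - of_bool (k < 0)"
  using diag_above[OF assms] above_step[OF assms, of k] by simp

lemma diag_eq_0:
  assumes "k < - int (length lam) \<or> int (part lam 1) < k" "is_partition lam"
  shows "diag lam k = 0"
proof -
  have "int j - int i \<noteq> k" if "(i, j) \<in> boxes lam" for i j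
    using that assms part_antimono[OF assms(2), of 1 i] by (auto simp: boxes_def part_def split: if_splits)
  then have "{b \<in> boxes lam. int (snd b) - int (fst b) = k} = {}" by auto
  then show ?thesis unfolding diag_def by (simp only: card.empty)
qed

section \<open>Hooks and cores\<close>

lemma box_iff_beads:
  assumes "is_partition lam" "1 \<le> i" "1 \<le> j"
  shows "(i, j) \<in> boxes lam \<longleftrightarrow>
    int j - int (part (conjugate lam) j) - 1 < int (part lam i) - int i"
proof -
  have "(i, j) \<in> boxes lam \<longleftrightarrow> j \<le> part lam i" using assms by (simp add: boxes_def)
  then show ?thesis using le_part_iff[OF assms] by linarith
qed

text \<open>The end of the arm is found from the bead of the row and the end of the leg from the gap of the column,
  so a hook is an interval of the word from a gap to a bead on its right.\<close>

lemma hook_beads: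
  assumes "is_partition lam" "(i, j) \<in> boxes lam"
  shows "int (hook lam (i, j))
    = (int (part lam i) - int i) - (int j - int (part (conjugate lam) j) - 1)"
proof -
  have ij: "1 \<le> i" "1 \<le> j" "j \<le> part lam i" using assms(2) by (auto simp: boxes_def)
  have i: "i \<le> part (conjugate lam) j" using le_part_iff[OF assms(1) ij(1,2)] ij(3) by simp
  have "{j'. j < j' \<and> (i, j') \<in> boxes lam} = {j<..part lam i}"
    using ij by (auto simp: boxes_def)
  moreover have "{i'. i < i' \<and> (i', j) \<in> boxes lam} = {i<..part (conjugate lam) j}"
    using ij le_part_iff[OF assms(1) _ ij(2)] by (auto simp: boxes_def)
  ultimately show ?thesis using ij i by (simp add: hook_def)
qed

lemma gap_iff:
  assumes "is_partition lam"
  shows "t \<notin> beta lam \<longleftrightarrow> (\<exists>j\<ge>1. t = int j - int (part (conjugate lam) j) - 1)"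
  using word_eq_1_iff[OF assms, of t] unfolding word_eq_1_beta by blast

text \<open>Removing a hook of length \<open>N\<close> moves a bead \<open>N\<close> places to the left; cores are the
  partitions for which all these places are taken.\<close>

lemma cores_iff:
  assumes "0 < N"
  shows "lam \<in> cores N \<longleftrightarrow> is_partition lam \<and> (\<forall>k\<in>beta lam. k - int N \<in> beta lam)"
proof (cases "is_partition lam")
  case True
  have "(\<exists>b\<in>boxes lam. hook lam b = N) \<longleftrightarrow> (\<exists>k\<in>beta lam. k - int N \<notin> beta lam)"
  proof
    assume "\<exists>b\<in>boxes lam. hook lam b = N"
    then obtain i j where ij: "(i, j) \<in> boxes lam" "hook lam (i, j) = N" by auto
    then have "1 \<le> i" "1 \<le> j" by (auto simp: boxes_def)
    then have "int (part lam i) - int i \<in> beta lam"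
      "(int (part lam i) - int i) - int N \<notin> beta lam"
      using hook_beads[OF True ij(1)] ij(2) gap_iff[OF True] by (auto simp: beta_def)
    then show "\<exists>k\<in>beta lam. k - int N \<notin> beta lam" by blast
  next
    assume "\<exists>k\<in>beta lam. k - int N \<notin> beta lam"
    then obtain i j where "1 \<le> i" "1 \<le> j"
      "int (part lam i) - int i - int N = int j - int (part (conjugate lam) j) - 1"
      using gap_iff[OF True] by (auto simp: beta_def)
    then show "\<exists>b\<in>boxes lam. hook lam b = N"
      using box_iff_beads[OF True, of i j] hook_beads[OF True, of i j] assms
      by (intro bexI[of _ "(i, j)"]) simp_all
  qed
  then show ?thesis using True by (auto simp: cores_def)
qed (simp add: cores_def)

lemma core_beta_shift:
  assumes "lam \<in> cores N" "0 < N" "k \<in> beta lam"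
  shows "k - int m * int N \<in> beta lam"
proof (induction m)
  case (Suc m)
  then have "k - int m * int N - int N \<in> beta lam" using assms(1,2) cores_iff by blast
  then show ?case by (simp add: algebra_simps)
qed (use assms(3) in simp)

section \<open>Corners\<close>

abbreviation content :: "nat \<times> nat \<Rightarrow> int" where
  "content b \<equiv> int (snd b) - int (fst b)"

lemma residue_content: "residue N b = content b mod int N"
  by (cases b) (simp add: residue_def)

lemma removable_iff:
  assumes "is_partition c"
  shows "(i, j) \<in> removable N r c \<longleftrightarrow> (i, j) \<in> boxes c \<and> (Suc i, j) \<notin> boxes c
    \<and> (i, Suc j) \<notin> boxes c \<and> residue N (i, j) = int r"
proof -
  have B: "finite (boxes c)" "\<And>i j. (i, j) \<in> boxes c \<Longrightarrow> 1 \<le> i \<and> 1 \<le> j"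
    "\<And>i j. (Suc i, j) \<in> boxes c \<Longrightarrow> 1 \<le> i \<Longrightarrow> (i, j) \<in> boxes c"
    "\<And>i j. (i, Suc j) \<in> boxes c \<Longrightarrow> 1 \<le> j \<Longrightarrow> (i, j) \<in> boxes c"
    using is_diagram_boxes[OF assms] unfolding is_diagram_iff by blast+
  have "is_diagram (boxes c - {(i, j)}) \<longleftrightarrow> (Suc i, j) \<notin> boxes c \<and> (i, Suc j) \<notin> boxes c"
    if b: "(i, j) \<in> boxes c"
  proof
    assume D: "is_diagram (boxes c - {(i, j)})"
    have "(Suc i, j) \<in> boxes c - {(i, j)} \<Longrightarrow> 1 \<le> i \<Longrightarrow> (i, j) \<in> boxes c - {(i, j)}"
      "(i, Suc j) \<in> boxes c - {(i, j)} \<Longrightarrow> 1 \<le> j \<Longrightarrow> (i, j) \<in> boxes c - {(i, j)}"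
      using D unfolding is_diagram_iff by blast+
    then show "(Suc i, j) \<notin> boxes c \<and> (i, Suc j) \<notin> boxes c" using B(2)[OF b] by auto
  next
    assume A: "(Suc i, j) \<notin> boxes c \<and> (i, Suc j) \<notin> boxes c"
    show "is_diagram (boxes c - {(i, j)})"
      unfolding is_diagram_iff
    proof (intro conjI allI impI)
      fix i' j'
      show "(i', j') \<in> boxes c - {(i, j)}" if "(Suc i', j') \<in> boxes c - {(i, j)}" "1 \<le> i'"
        using that A B(3)[of i' j'] by auto
      show "(i', j') \<in> boxes c - {(i, j)}" if "(i', Suc j') \<in> boxes c - {(i, j)}" "1 \<le> j'"
        using that A B(4)[of i' j'] by auto
      show "1 \<le> i'" "1 \<le> j'" if "(i', j') \<in> boxes c - {(i, j)}"
        using that B(2)[of i' j'] by auto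
    qed (use B(1) in simp)
  qed
  then show ?thesis unfolding removable_def by blast
qed

lemma addable_iff:
  assumes "is_partition c"
  shows "(i, j) \<in> addable N r c \<longleftrightarrow> (i, j) \<notin> boxes c \<and> 1 \<le> i \<and> 1 \<le> j
    \<and> (i = 1 \<or> (i - 1, j) \<in> boxes c) \<and> (j = 1 \<or> (i, j - 1) \<in> boxes c)
    \<and> residue N (i, j) = int r"
proof -
  have B: "finite (boxes c)" "\<And>i j. (i, j) \<in> boxes c \<Longrightarrow> 1 \<le> i \<and> 1 \<le> j"
    "\<And>i j. (Suc i, j) \<in> boxes c \<Longrightarrow> 1 \<le> i \<Longrightarrow> (i, j) \<in> boxes c"
    "\<And>i j. (i, Suc j) \<in> boxes c \<Longrightarrow> 1 \<le> j \<Longrightarrow> (i, j) \<in> boxes c"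
    using is_diagram_boxes[OF assms] unfolding is_diagram_iff by blast+
  have "is_diagram (insert (i, j) (boxes c)) \<longleftrightarrow> 1 \<le> i \<and> 1 \<le> j
    \<and> (i = 1 \<or> (i - 1, j) \<in> boxes c) \<and> (j = 1 \<or> (i, j - 1) \<in> boxes c)"
    if "(i, j) \<notin> boxes c"
  proof
    assume D: "is_diagram (insert (i, j) (boxes c))"
    have D1: "1 \<le> i" "1 \<le> j"
      and D2: "\<And>i'. i = Suc i' \<Longrightarrow> 1 \<le> i' \<Longrightarrow> (i', j) \<in> insert (i, j) (boxes c)"
      and D3: "\<And>j'. j = Suc j' \<Longrightarrow> 1 \<le> j' \<Longrightarrow> (i, j') \<in> insert (i, j) (boxes c)"
      using D unfolding is_diagram_iff by blast+
    show "1 \<le> i \<and> 1 \<le> j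
      \<and> (i = 1 \<or> (i - 1, j) \<in> boxes c) \<and> (j = 1 \<or> (i, j - 1) \<in> boxes c)"
    proof (intro conjI)
      show "i = 1 \<or> (i - 1, j) \<in> boxes c" using D1 D2[of "i - 1"] by (cases "1 \<le> i - 1") auto
      show "j = 1 \<or> (i, j - 1) \<in> boxes c" using D1 D3[of "j - 1"] by (cases "1 \<le> j - 1") auto
    qed (use D1 in auto)
  next
    assume A: "1 \<le> i \<and> 1 \<le> j
      \<and> (i = 1 \<or> (i - 1, j) \<in> boxes c) \<and> (j = 1 \<or> (i, j - 1) \<in> boxes c)"
    show "is_diagram (insert (i, j) (boxes c))"
      unfolding is_diagram_iff
    proof (intro conjI allI impI)
      fix i' j'
      show "(i', j') \<in> insert (i, j) (boxes c)"
        if "(Suc i', j') \<in> insert (i, j) (boxes c)" "1 \<le> i'"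
        using that A B(3)[of i' j'] by auto
      show "(i', j') \<in> insert (i, j) (boxes c)"
        if "(i', Suc j') \<in> insert (i, j) (boxes c)" "1 \<le> j'"
        using that A B(4)[of i' j'] by auto
      show "1 \<le> i'" "1 \<le> j'" if "(i', j') \<in> insert (i, j) (boxes c)"
        using that A B(2)[of i' j'] by auto
    qed (use B(1) in simp)
  qed
  then show ?thesis unfolding addable_def by blast
qed

text \<open>Here \<open>a\<close>, \<open>b\<close>, \<open>d\<close> stand for the numbers \<open>above c k\<close>, \<open>above c (k - 1)\<close>, \<open>above c (k + 1)\<close>, and \<open>P\<close>, \<open>Q\<close>
  tell whether \<open>k\<close> and \<open>k - 1\<close> are beads.\<close>

lemma corner_arith:
  fixes i j a b d :: nat and k :: int
  assumes "int j = int i + k" "int a = int d + of_bool P" "int b = int a + of_bool Q"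
    "- k \<le> int a" "1 - k \<le> int b"
  shows "1 \<le> i \<and> 1 \<le> j \<and> i \<le> a \<and> \<not> Suc i \<le> b \<and> \<not> i \<le> d \<longleftrightarrow> i = a \<and> P \<and> \<not> Q"
    and "1 \<le> i \<and> 1 \<le> j \<and> \<not> i \<le> a \<and> (i = 1 \<or> i - 1 \<le> d) \<and> (j = 1 \<or> i \<le> b)
      \<longleftrightarrow> i = Suc a \<and> Q \<and> \<not> P"
proof -
  show "1 \<le> i \<and> 1 \<le> j \<and> i \<le> a \<and> \<not> Suc i \<le> b \<and> \<not> i \<le> d \<longleftrightarrow> i = a \<and> P \<and> \<not> Q"
    using assms by (cases P; cases Q) (simp_all, presburger+)
  show "1 \<le> i \<and> 1 \<le> j \<and> \<not> i \<le> a \<and> (i = 1 \<or> i - 1 \<le> d) \<and> (j = 1 \<or> i \<le> b)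
      \<longleftrightarrow> i = Suc a \<and> Q \<and> \<not> P"
    using assms by (cases P; cases Q) (simp_all, presburger+)
qed

text \<open>A box is removable if it is the last one on its diagonal and the neighbouring diagonals do not reach
  beyond it, so the lengths of three consecutive diagonals decide. They are governed by the word: a
  removable box of content \<open>k\<close> is a bead at \<open>k\<close> with a gap on its left, an addable box of content \<open>k\<close> a
  bead at \<open>k - 1\<close> with a gap on its right.\<close>

lemma removable_beta:
  assumes "is_partition c"
  shows "removable N r c = (\<lambda>k. (above c k, nat (int (above c k) + k)))
    ` {k. k \<in> beta c \<and> k - 1 \<notin> beta c \<and> k mod int N = int r}"
proof (intro set_eqI, clarify)
  fix i j :: nat
  define k where "k = int j - int i"
  note ab = above_step[OF assms, of k] above_step[OF assms, of "k - 1"] above_ge[OF assms, of k]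
    above_ge[OF assms, of "k - 1"]
  have "int (Suc j) - int i = k + 1" "int j - int (Suc i) = k - 1" by (auto simp: k_def)
  then have mem: "(i, j) \<in> boxes c \<longleftrightarrow> 1 \<le> i \<and> 1 \<le> j \<and> i \<le> above c k"
    "(Suc i, j) \<in> boxes c \<longleftrightarrow> 1 \<le> j \<and> Suc i \<le> above c (k - 1)"
    "(i, Suc j) \<in> boxes c \<longleftrightarrow> 1 \<le> i \<and> i \<le> above c (k + 1)"
    unfolding mem_boxes_above[OF assms] by (simp_all only: k_def) simp_all
  have "(i, j) \<in> removable N r c \<longleftrightarrow> 1 \<le> i \<and> 1 \<le> j \<and> i \<le> above c k
      \<and> \<not> Suc i \<le> above c (k - 1) \<and> \<not> i \<le> above c (k + 1) \<and> k mod int N = int r"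
    unfolding removable_iff[OF assms] mem by (auto simp: residue_content k_def)
  also have "\<dots> \<longleftrightarrow> i = above c k \<and> k \<in> beta c \<and> k - 1 \<notin> beta c \<and> k mod int N = int r"
    using corner_arith(1)[of j i k "above c k" "above c (k + 1)" "k \<in> beta c" "above c (k - 1)"
      "k - 1 \<in> beta c"] ab by (simp add: k_def del: of_bool_eq_iff) blast
  also have "\<dots> \<longleftrightarrow> (i, j) \<in> (\<lambda>k. (above c k, nat (int (above c k) + k)))
    ` {k. k \<in> beta c \<and> k - 1 \<notin> beta c \<and> k mod int N = int r}"
  proof -
    have "(i, j) = (above c x, nat (int (above c x) + x)) \<longleftrightarrow> x = k \<and> i = above c k" for x
      using above_ge[OF assms, of x] above_ge[OF assms, of k] by (auto simp: k_def)
    then show ?thesis unfolding image_iff by auto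
  qed
  finally show "(i, j) \<in> removable N r c \<longleftrightarrow> (i, j) \<in> (\<lambda>k. (above c k, nat (int (above c k) + k)))
    ` {k. k \<in> beta c \<and> k - 1 \<notin> beta c \<and> k mod int N = int r}" .
qed

lemma addable_beta:
  assumes "is_partition c"
  shows "addable N r c = (\<lambda>k. (Suc (above c k), nat (int (Suc (above c k)) + k)))
    ` {k. k - 1 \<in> beta c \<and> k \<notin> beta c \<and> k mod int N = int r}"
proof (intro set_eqI, clarify)
  fix i j :: nat
  define k where "k = int j - int i"
  note ab = above_step[OF assms, of k] above_step[OF assms, of "k - 1"] above_ge[OF assms, of k]
    above_ge[OF assms, of "k - 1"]
  have "(i, j) \<in> addable N r c \<longleftrightarrow> 1 \<le> i \<and> 1 \<le> j \<and> \<not> i \<le> above c k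
      \<and> (i = 1 \<or> i - 1 \<le> above c (k + 1)) \<and> (j = 1 \<or> i \<le> above c (k - 1)) \<and> k mod int N = int r"
  proof (cases "1 \<le> i \<and> 1 \<le> j")
    case True
    then have e: "int j - int (i - 1) = k + 1" "int (j - 1) - int i = k - 1" by (auto simp: k_def)
    have mem: "(i, j) \<in> boxes c \<longleftrightarrow> i \<le> above c k"
      "(i - 1, j) \<in> boxes c \<longleftrightarrow> i \<noteq> 1 \<and> i - 1 \<le> above c (k + 1)"
      "(i, j - 1) \<in> boxes c \<longleftrightarrow> j \<noteq> 1 \<and> i \<le> above c (k - 1)"
      using True unfolding mem_boxes_above[OF assms] e k_def[symmetric] by auto
    show ?thesis using True
      unfolding addable_iff[OF assms] mem by (auto simp: residue_content k_def)
  qed (use addable_iff[OF assms] in auto)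
  also have "\<dots> \<longleftrightarrow> i = Suc (above c k) \<and> k - 1 \<in> beta c \<and> k \<notin> beta c \<and> k mod int N = int r"
    using corner_arith(2)[of j i k "above c k" "above c (k + 1)" "k \<in> beta c" "above c (k - 1)"
      "k - 1 \<in> beta c"] ab by (simp add: k_def del: of_bool_eq_iff) blast
  also have "\<dots> \<longleftrightarrow> (i, j) \<in> (\<lambda>k. (Suc (above c k), nat (int (Suc (above c k)) + k)))
    ` {k. k - 1 \<in> beta c \<and> k \<notin> beta c \<and> k mod int N = int r}"
  proof -
    have "(i, j) = (Suc (above c x), nat (int (Suc (above c x)) + x))
      \<longleftrightarrow> x = k \<and> i = Suc (above c k)" for x
      using above_ge[OF assms, of x] above_ge[OF assms, of k] by (auto simp: k_def)
    then show ?thesis unfolding image_iff by auto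
  qed
  finally show "(i, j) \<in> addable N r c \<longleftrightarrow> (i, j) \<in> (\<lambda>k. (Suc (above c k), nat (int (Suc (above c k)) + k)))
    ` {k. k - 1 \<in> beta c \<and> k \<notin> beta c \<and> k mod int N = int r}" .
qed

lemma finite_corners:
  assumes "is_partition c"
  shows "finite {k. k \<in> beta c \<and> k - 1 \<notin> beta c \<and> P k}"
    "finite {k. k - 1 \<in> beta c \<and> k \<notin> beta c \<and> P k}"
proof -
  note b = beta_bounds[OF assms]
  have "k \<in> beta c \<and> k - 1 \<notin> beta c \<Longrightarrow> k \<in> {- int (length c)..int (part c 1) + 1}"
    "k - 1 \<in> beta c \<and> k \<notin> beta c \<Longrightarrow> k \<in> {- int (length c)..int (part c 1) + 1}" for k
    using b(1)[of k] b(1)[of "k - 1"] b(2)[of k] b(2)[of "k - 1"] by force+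
  then show "finite {k. k \<in> beta c \<and> k - 1 \<notin> beta c \<and> P k}"
    "finite {k. k - 1 \<in> beta c \<and> k \<notin> beta c \<and> P k}"
    by (auto intro!: finite_subset[of _ "{- int (length c)..int (part c 1) + 1}"])
qed

section \<open>The action of a simple reflection\<close>

text \<open>A box with a neighbour below or to the right is not removable, so removable boxes can be taken away
  all at once. In the same way the box above or to the left of an addable box is already there.\<close>

lemma is_diagram_remove:
  assumes "is_partition c"
  shows "is_diagram (boxes c - removable N r c)"
proof -
  have B: "finite (boxes c)" "\<And>i j. (i, j) \<in> boxes c \<Longrightarrow> 1 \<le> i \<and> 1 \<le> j"
    "\<And>i j. (Suc i, j) \<in> boxes c \<Longrightarrow> 1 \<le> i \<Longrightarrow> (i, j) \<in> boxes c"
    "\<And>i j. (i, Suc j) \<in> boxes c \<Longrightarrow> 1 \<le> j \<Longrightarrow> (i, j) \<in> boxes c"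
    using is_diagram_boxes[OF assms] unfolding is_diagram_iff by blast+
  show ?thesis unfolding is_diagram_iff
  proof (intro conjI allI impI)
    fix i j
    show "(i, j) \<in> boxes c - removable N r c"
      if "(Suc i, j) \<in> boxes c - removable N r c" "1 \<le> i"
      using that B(3)[of i j] removable_iff[OF assms, of i j] by auto
    show "(i, j) \<in> boxes c - removable N r c"
      if "(i, Suc j) \<in> boxes c - removable N r c" "1 \<le> j"
      using that B(4)[of i j] removable_iff[OF assms, of i j] by auto
    show "1 \<le> i" "1 \<le> j" if "(i, j) \<in> boxes c - removable N r c"
      using that B(2)[of i j] by auto
  qed (use B(1) in simp)
qed

lemma finite_addable: "is_partition c \<Longrightarrow> finite (addable N r c)"
  using finite_corners(2)[of c "\<lambda>k. k mod int N = int r"] by (simp add: addable_beta)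

lemma is_diagram_add:
  assumes "is_partition c"
  shows "is_diagram (boxes c \<union> addable N r c)"
proof -
  have B: "finite (boxes c)" "\<And>i j. (i, j) \<in> boxes c \<Longrightarrow> 1 \<le> i \<and> 1 \<le> j"
    "\<And>i j. (Suc i, j) \<in> boxes c \<Longrightarrow> 1 \<le> i \<Longrightarrow> (i, j) \<in> boxes c"
    "\<And>i j. (i, Suc j) \<in> boxes c \<Longrightarrow> 1 \<le> j \<Longrightarrow> (i, j) \<in> boxes c"
    using is_diagram_boxes[OF assms] unfolding is_diagram_iff by blast+
  show ?thesis unfolding is_diagram_iff
  proof (intro conjI allI impI)
    fix i j
    show "(i, j) \<in> boxes c \<union> addable N r c"
      if "(Suc i, j) \<in> boxes c \<union> addable N r c" "1 \<le> i"
      using that B(3)[of i j] addable_iff[OF assms, of "Suc i" j] by auto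
    show "(i, j) \<in> boxes c \<union> addable N r c"
      if "(i, Suc j) \<in> boxes c \<union> addable N r c" "1 \<le> j"
      using that B(4)[of i j] addable_iff[OF assms, of i "Suc j"] by auto
    show "1 \<le> i" "1 \<le> j" if "(i, j) \<in> boxes c \<union> addable N r c"
      using that B(2)[of i j] addable_iff[OF assms, of i j] by auto
  qed (use B(1) finite_addable[OF assms] in simp)
qed

lemma card_removable_diag:
  assumes "is_partition c"
  shows "card {b \<in> removable N r c. content b = k}
    = of_bool (k mod int N = int r \<and> k \<in> beta c \<and> k - 1 \<notin> beta c)"
proof -
  have "content (above c x, nat (int (above c x) + x)) = x" for x
    using above_ge[OF assms, of x] by simp
  then have "{b \<in> removable N r c. content b = k} =
    (if k mod int N = int r \<and> k \<in> beta c \<and> k - 1 \<notin> beta c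
     then {(above c k, nat (int (above c k) + k))} else {})"
    unfolding removable_beta[OF assms] by auto
  then show ?thesis by simp
qed

lemma card_addable_diag:
  assumes "is_partition c"
  shows "card {b \<in> addable N r c. content b = k}
    = of_bool (k mod int N = int r \<and> k - 1 \<in> beta c \<and> k \<notin> beta c)"
proof -
  have "content (Suc (above c x), nat (int (Suc (above c x)) + x)) = x" for x
    using above_ge[OF assms, of x] by simp
  then have "{b \<in> addable N r c. content b = k} =
    (if k mod int N = int r \<and> k - 1 \<in> beta c \<and> k \<notin> beta c
     then {(Suc (above c k), nat (int (Suc (above c k)) + k))} else {})"
    unfolding addable_beta[OF assms] by auto
  then show ?thesis by simp
qed

lemma core_partition: "c \<in> cores N \<Longrightarrow> is_partition c"
  by (simp add: cores_def)

lemma mod_eq_obtain: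
  fixes k k' :: int
  assumes "k mod int N = k' mod int N" "k' \<le> k"
  obtains m where "k' = k - int m * int N"
proof (cases "N = 0")
  case False
  have "int N dvd k - k'" using assms(1) by (simp add: mod_eq_dvd_iff)
  then obtain q where q: "k - k' = int N * q" by (rule dvdE)
  then have "0 \<le> int N * q" using assms(2) by simp
  then have "0 \<le> q" using False by (simp add: zero_le_mult_iff)
  then have "k' = k - int (nat q) * int N" using q by (simp add: mult.commute)
  then show ?thesis by (rule that)
qed (use assms that[of 0] in simp)

text \<open>A core does not have an addable and a removable box of the same residue: whichever of the
  two positions lies further to the right, moving to the other one in steps of \<open>N\<close> to the left
  stays within the beta-set.\<close>

lemma not_addable_and_removable:
  assumes "c \<in> cores N" "0 < N" "k mod int N = k' mod int N"
    and "k \<in> beta c" "k - 1 \<notin> beta c" "k' - 1 \<in> beta c"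
  shows "k' \<in> beta c"
proof (cases "k' \<le> k")
  case True
  then obtain m where "k' = k - int m * int N" using mod_eq_obtain[OF assms(3)] by blast
  then show ?thesis using core_beta_shift[OF assms(1,2,4)] by simp
next
  case False
  then obtain m where "k = k' - int m * int N" using mod_eq_obtain[OF assms(3)[symmetric]] by auto
  then have "k - 1 = k' - 1 - int m * int N" by simp
  then have "k - 1 \<in> beta c" using core_beta_shift[OF assms(1,2,6), of m] by metis
  then show ?thesis using assms(5) by contradiction
qed

lemma is_partition_core_refl:
  assumes "is_partition c"
  shows "is_partition (core_refl N r c)"
  using partition_of_diagram[OF is_diagram_remove[OF assms]]
    partition_of_diagram[OF is_diagram_add[OF assms]] assms
  by (simp add: core_refl_def)

lemma boxes_core_refl:
  assumes "is_partition c"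
  shows "boxes (core_refl N r c) =
    (if removable N r c \<noteq> {} then boxes c - removable N r c else boxes c \<union> addable N r c)"
  using partition_of_diagram[OF is_diagram_remove[OF assms]]
    partition_of_diagram[OF is_diagram_add[OF assms]]
  by (simp add: core_refl_def)

text \<open>A core cannot have both removable and addable boxes of residue \<open>r\<close>. Hence the difference on the right is
  negative exactly on the diagonals that lose a box in the first case, positive exactly on those that gain
  one in the second, and both cases are covered by one formula.\<close>

lemma diag_core_refl:
  assumes "c \<in> cores N" "0 < N"
  shows "int (diag (core_refl N r c) k) = int (diag c k)
    + of_bool (k mod int N = int r) * (of_bool (k - 1 \<in> beta c) - of_bool (k \<in> beta c))"
proof -
  have c: "is_partition c" using assms(1) by (rule core_partition)
  show ?thesis
  proof (cases "removable N r c = {}")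
    case False
    then obtain l where l: "l \<in> beta c" "l - 1 \<notin> beta c" "l mod int N = int r"
      unfolding removable_beta[OF c] by auto
    have na: "k \<in> beta c" if "k - 1 \<in> beta c" "k mod int N = int r"
      using not_addable_and_removable[OF assms, of l k] l that by simp
    have "{b \<in> boxes c. content b = k} = {b \<in> boxes (core_refl N r c). content b = k}
      \<union> {b \<in> removable N r c. content b = k}"
      using False by (auto simp: boxes_core_refl[OF c] removable_def)
    moreover have "{b \<in> boxes (core_refl N r c). content b = k}
      \<inter> {b \<in> removable N r c. content b = k} = {}"
      using False by (auto simp: boxes_core_refl[OF c])
    moreover have "finite (removable N r c)"
      by (rule finite_subset[OF _ finite_boxes[of c]]) (auto simp: removable_def)
    ultimately have "diag c k = diag (core_refl N r c) k + card {b \<in> removable N r c. content b = k}"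
      unfolding diag_def by (simp add: card_Un_disjoint finite_boxes)
    then show ?thesis using na by (auto simp: card_removable_diag[OF c])
  next
    case True
    have nr: "k - 1 \<in> beta c" if "k \<in> beta c" "k mod int N = int r"
      using True that unfolding removable_beta[OF c] by auto
    have "{b \<in> boxes (core_refl N r c). content b = k} = {b \<in> boxes c. content b = k}
      \<union> {b \<in> addable N r c. content b = k}"
      using True by (auto simp: boxes_core_refl[OF c])
    moreover have "{b \<in> boxes c. content b = k} \<inter> {b \<in> addable N r c. content b = k} = {}"
      by (auto simp: addable_def)
    ultimately have "diag (core_refl N r c) k = diag c k + card {b \<in> addable N r c. content b = k}"
      unfolding diag_def by (simp add: card_Un_disjoint finite_boxes finite_addable[OF c])
    then show ?thesis using nr by (auto simp: card_addable_diag[OF c])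
  qed
qed

text \<open>The reflection acts on the word by this permutation of the positions.\<close>

definition swap_pos :: "nat \<Rightarrow> nat \<Rightarrow> int \<Rightarrow> int" where
  "swap_pos N r k = (if k mod int N = int r then k - 1
                     else if (k + 1) mod int N = int r then k + 1 else k)"

lemma succ_residue_neq:
  assumes "2 \<le> N"
  shows "(k + 1) mod int N \<noteq> k mod int N"
proof
  assume "(k + 1) mod int N = k mod int N"
  then have "int N dvd 1" by (simp add: mod_eq_dvd_iff)
  then show False using assms by (simp add: zdvd1_eq)
qed

text \<open>The word is the difference of the lengths of consecutive diagonals, so the change of these lengths
  gives the new word.\<close>

lemma beta_core_refl:
  assumes "c \<in> cores N" "2 \<le> N"
  shows "k \<in> beta (core_refl N r c) \<longleftrightarrow> swap_pos N r k \<in> beta c"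
proof -
  have c: "is_partition c" using assms(1) by (rule core_partition)
  have N: "0 < N" using assms(2) by simp
  define g where "g k = of_bool (k mod int N = int r)
    * (of_bool (k - 1 \<in> beta c) - of_bool (k \<in> beta c) :: int)" for k
  have "of_bool (k \<in> beta (core_refl N r c)) = (of_bool (k \<in> beta c) :: int) + g k - g (k + 1)"
    using diag_step[OF is_partition_core_refl[OF c, of N r], of k] diag_step[OF c, of k]
      diag_core_refl[OF assms(1) N, of r k, folded g_def]
      diag_core_refl[OF assms(1) N, of r "k + 1", folded g_def] by linarith
  also have "\<dots> = of_bool (swap_pos N r k \<in> beta c)"
    using succ_residue_neq[OF assms(2), of k] by (auto simp: g_def swap_pos_def)
  finally show ?thesis by (simp only: of_bool_eq_iff)
qed

lemma swap_pos_shift: "swap_pos N r (k - int N) = swap_pos N r k - int N"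
proof -
  have "(k - int N) mod int N = k mod int N" "(k - int N + 1) mod int N = (k + 1) mod int N"
    by (simp_all add: mod_eq_dvd_iff)
  then show ?thesis by (simp add: swap_pos_def)
qed

lemma core_refl_core:
  assumes "c \<in> cores N" "2 \<le> N"
  shows "core_refl N r c \<in> cores N"
proof -
  have N: "0 < N" using assms(2) by simp
  have "k - int N \<in> beta (core_refl N r c)" if "k \<in> beta (core_refl N r c)" for k
    using that assms(1) unfolding cores_iff[OF N] beta_core_refl[OF assms] swap_pos_shift by blast
  then show ?thesis
    using is_partition_core_refl[OF core_partition[OF assms(1)]] unfolding cores_iff[OF N] by blast
qed

section \<open>Weights and residues of boxes\<close>

definition residue_count :: "nat \<Rightarrow> nat list \<Rightarrow> nat \<Rightarrow> int" where
  "residue_count N c r = int (card {b \<in> boxes c. residue N b = int r})"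

text \<open>Sums over all diagonals are written over a symmetric window beyond which the diagonals are empty; such
  a window may be shifted by one without changing the sum.\<close>

lemma residue_count_diag:
  assumes "is_partition c" "int (length c) \<le> L" "int (part c 1) \<le> L"
  shows "residue_count N c r = (\<Sum>k\<in>{-L..L}. of_bool (k mod int N = int r) * int (diag c k))"
proof -
  have c: "content b \<in> {-L..L}" if "b \<in> boxes c" for b
  proof (rule ccontr)
    assume "content b \<notin> {-L..L}"
    then have "diag c (content b) = 0" using diag_eq_0[OF _ assms(1)] assms(2,3) by force
    moreover have "b \<in> {b' \<in> boxes c. content b' = content b}" using that by simp
    ultimately show False using finite_boxes[of c] unfolding diag_def
      by (metis (no_types, lifting) card_0_eq empty_iff finite_subset mem_Collect_eq subsetI)
  qed
  have "{b \<in> boxes c. residue N b = int r}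
    = (\<Union>k\<in>{k\<in>{-L..L}. k mod int N = int r}. {b \<in> boxes c. content b = k})"
    using c by (auto simp: residue_content)
  moreover have "card (\<Union>k\<in>{k\<in>{-L..L}. k mod int N = int r}. {b \<in> boxes c. content b = k})
    = (\<Sum>k\<in>{k\<in>{-L..L}. k mod int N = int r}. diag c k)"
    unfolding diag_def by (rule card_UN_disjoint) (auto simp: finite_boxes intro: finite_subset[of _ "{-L..L}"])
  ultimately have "residue_count N c r = (\<Sum>k\<in>{k\<in>{-L..L}. k mod int N = int r}. int (diag c k))"
    by (simp add: residue_count_def)
  also have "\<dots> = (\<Sum>k\<in>{-L..L}. if k mod int N = int r then int (diag c k) else 0)"
    by (rule sum.inter_filter) simp
  also have "\<dots> = (\<Sum>k\<in>{-L..L}. of_bool (k mod int N = int r) * int (diag c k))"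
    by (rule sum.cong) auto
  finally show ?thesis .
qed

lemma sum_window_shift:
  fixes f :: "int \<Rightarrow> int"
  assumes "0 \<le> L" "f (-L) = 0" "f (L + 1) = 0"
  shows "(\<Sum>k\<in>{-L..L}. f (k + 1)) = (\<Sum>k\<in>{-L..L}. f k)"
proof -
  have "(\<Sum>k\<in>{-L..L}. f (k + 1)) = (\<Sum>k\<in>{-L + 1..L + 1}. f k)"
    by (rule sum.reindex_bij_witness[of _ "\<lambda>k. k - 1" "\<lambda>k. k + 1"]) auto
  also have "\<dots> = (\<Sum>k\<in>{-L + 1..L}. f k)"
  proof (rule sum.mono_neutral_right)
    have "{-L + 1..L + 1} - {-L + 1..L} \<subseteq> {L + 1}" by auto
    then show "\<forall>k\<in>{-L + 1..L + 1} - {-L + 1..L}. f k = 0" using assms(3) by auto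
  qed auto
  also have "\<dots> = (\<Sum>k\<in>{-L..L}. f k)"
  proof (rule sum.mono_neutral_left)
    have "{-L..L} - {-L + 1..L} \<subseteq> {-L}" by auto
    then show "\<forall>k\<in>{-L..L} - {-L + 1..L}. f k = 0" using assms(2) by auto
  qed auto
  finally show ?thesis .
qed


lemma mod_succ_iff:
  assumes "r < N"
  shows "(k + 1) mod int N = int ((r + 1) mod N) \<longleftrightarrow> k mod int N = int r"
proof -
  have "int ((r + 1) mod N) = (int r + 1) mod int N" by (simp add: zmod_int add.commute)
  then have "(k + 1) mod int N = int ((r + 1) mod N) \<longleftrightarrow> k mod int N = int r mod int N"
    by (simp add: mod_eq_dvd_iff)
  then show ?thesis using assms by simp
qed

lemma pred_succ_mod:
  fixes r N :: nat
  assumes "r < N"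
  shows "((if r = 0 then N - 1 else r - 1) + 1) mod N = r" "(if r = 0 then N - 1 else r - 1) < N"
  using assms by auto

text \<open>The left-hand side is the value of a simple coroot at the weight of \<open>c\<close>, the sum on the right the number
  of addable minus the number of removable boxes of residue \<open>r\<close>. On each diagonal the latter is a second
  difference of the lengths of diagonals, up to 1 for the main diagonal; this 1 is the contribution of
  the fundamental weight.\<close>

lemma residue_count_second_difference:
  assumes "is_partition c" "int (length c) < L" "int (part c 1) < L" "r < N"
  shows "of_bool (r = 0) - 2 * residue_count N c r + residue_count N c ((r + 1) mod N)
      + residue_count N c (if r = 0 then N - 1 else r - 1)
    = (\<Sum>k\<in>{-L..L}. of_bool (k mod int N = int r) * (of_bool (k - 1 \<in> beta c) - of_bool (k \<in> beta c)))"
proof -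
  let ?p = "if r = 0 then N - 1 else r - 1"
  let ?e = "\<lambda>k. of_bool (k mod int N = int r) :: int"
  have L: "0 \<le> L" "int (length c) \<le> L" "int (part c 1) \<le> L" using assms by linarith+
  note cnt = residue_count_diag[OF assms(1) L(2,3), of N]
  have z: "diag c (-L) = 0" "diag c (L + 1) = 0" "diag c (- L - 1) = 0" "diag c L = 0"
    using diag_eq_0[OF _ assms(1)] assms(2,3) by simp_all
  have "residue_count N c ((r + 1) mod N)
    = (\<Sum>k\<in>{-L..L}. of_bool ((k + 1) mod int N = int ((r + 1) mod N)) * int (diag c (k + 1)))"
    unfolding cnt by (rule sum_window_shift[symmetric]) (use L z in auto)
  then have up: "residue_count N c ((r + 1) mod N) = (\<Sum>k\<in>{-L..L}. ?e k * int (diag c (k + 1)))"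
    unfolding mod_succ_iff[OF assms(4)] .
  have eq: "k mod int N = int ?p \<longleftrightarrow> (k + 1) mod int N = int r" for k
    using mod_succ_iff[OF pred_succ_mod(2)[OF assms(4)], of k] pred_succ_mod(1)[OF assms(4)] by simp
  have "residue_count N c ?p
    = (\<Sum>k\<in>{-L..L}. ?e (k + 1) * int (diag c ((k + 1) - 1)))"
    unfolding cnt eq by simp
  also have "\<dots> = (\<Sum>k\<in>{-L..L}. ?e k * int (diag c (k - 1)))"
    by (rule sum_window_shift) (use L z in auto)
  finally have down: "residue_count N c ?p = (\<Sum>k\<in>{-L..L}. ?e k * int (diag c (k - 1)))" .
  have "of_bool (r = 0) = (\<Sum>k\<in>{-L..L}. ?e k * of_bool (k = 0))"
    using L(1) assms(4) by (subst sum.remove[of _ 0]) (auto intro!: sum.neutral)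
  then have "of_bool (r = 0) - 2 * residue_count N c r + residue_count N c ((r + 1) mod N)
      + residue_count N c ?p
    = (\<Sum>k\<in>{-L..L}. ?e k * of_bool (k = 0) - 2 * (?e k * int (diag c k))
        + ?e k * int (diag c (k + 1)) + ?e k * int (diag c (k - 1)))"
    unfolding up down cnt[of r] by (simp only: sum.distrib sum_subtractf sum_distrib_left)
  also have "\<dots> = (\<Sum>k\<in>{-L..L}. ?e k * (of_bool (k - 1 \<in> beta c) - of_bool (k \<in> beta c)))"
  proof (rule sum.cong)
    fix k
    have "of_bool (k = 0) - 2 * int (diag c k) + int (diag c (k + 1)) + int (diag c (k - 1))
      = of_bool (k - 1 \<in> beta c) - of_bool (k \<in> beta c)"
      using diag_step[OF assms(1), of k] diag_step[OF assms(1), of "k - 1"]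
      by (cases "k < 0"; cases "k = 0") auto
    then show "?e k * of_bool (k = 0) - 2 * (?e k * int (diag c k))
        + ?e k * int (diag c (k + 1)) + ?e k * int (diag c (k - 1))
      = ?e k * (of_bool (k - 1 \<in> beta c) - of_bool (k \<in> beta c))"
      by (cases "k mod int N = int r") simp_all
  qed simp
  finally show ?thesis .
qed

lemma residue_count_core_refl:
  assumes "c \<in> cores N" "r < N"
  shows "residue_count N (core_refl N r c) j = residue_count N c j
    + (if j = r then of_bool (r = 0) - 2 * residue_count N c r + residue_count N c ((r + 1) mod N)
        + residue_count N c (if r = 0 then N - 1 else r - 1) else 0)"
proof -
  have c: "is_partition c" using assms(1) by (rule core_partition)
  have N: "0 < N" using assms(2) by simp
  let ?d = "core_refl N r c"
  have d: "is_partition ?d" using c by (rule is_partition_core_refl)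
  define L where "L = 1 + int (max (max (length c) (part c 1)) (max (length ?d) (part ?d 1)))"
  have L: "int (length c) < L" "int (part c 1) < L" "int (length ?d) < L" "int (part ?d 1) < L"
    by (auto simp: L_def)
  let ?g = "\<lambda>k. of_bool (k - 1 \<in> beta c) - of_bool (k \<in> beta c) :: int"
  have "residue_count N ?d j = (\<Sum>k\<in>{-L..L}. of_bool (k mod int N = int j)
      * (int (diag c k) + of_bool (k mod int N = int r) * ?g k))"
    unfolding residue_count_diag[OF d less_imp_le[OF L(3)] less_imp_le[OF L(4)]]
      diag_core_refl[OF assms(1) N] ..
  also have "\<dots> = (\<Sum>k\<in>{-L..L}. of_bool (k mod int N = int j) * int (diag c k)
      + (if j = r then of_bool (k mod int N = int r) * ?g k else 0))"
    by (rule sum.cong) auto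
  also have "\<dots> = residue_count N c j
      + (if j = r then \<Sum>k\<in>{-L..L}. of_bool (k mod int N = int r) * ?g k else 0)"
    unfolding sum.distrib residue_count_diag[OF c less_imp_le[OF L(1)] less_imp_le[OF L(2)]] by simp
  finally show ?thesis
    using residue_count_second_difference[OF c L(1,2) assms(2)] by simp
qed

text \<open>This is the image of \<open>Lam0\<close> under any element of the Weyl group that takes the empty core to \<open>c\<close>, as
  shown below.\<close>

definition core_weight :: "nat \<Rightarrow> nat list \<Rightarrow> weight" where
  "core_weight N c = frag_of Lam0 - (\<Sum>j<N. frag_cmul (residue_count N c j) (frag_of (Alpha j)))"

lemma lookup_core_weight:
  "Poly_Mapping.lookup (core_weight N c) Lam0 = 1"
  "Poly_Mapping.lookup (core_weight N c) (Alpha j) = (if j < N then - residue_count N c j else 0)"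
  by (auto simp: core_weight_def lookup_minus lookup_sum if_distrib cong: if_cong)

lemma sum_cartan_A:
  fixes x :: "nat \<Rightarrow> int"
  assumes "3 \<le> N" "r < N"
  shows "(\<Sum>j<N. cartan_A N r j * x j)
    = 2 * x r - x ((r + 1) mod N) - x (if r = 0 then N - 1 else r - 1)"
proof -
  let ?p = "if r = 0 then N - 1 else r - 1"
  let ?q = "(r + 1) mod N"
  have q: "?q = (if r + 1 = N then 0 else r + 1)" using assms(2) by simp
  have "?q \<noteq> r \<and> ?p \<noteq> r \<and> ?q \<noteq> ?p \<and> ?q < N \<and> ?p < N"
    unfolding q using assms by (cases "r = 0"; cases "r + 1 = N") auto
  then have distinct: "?q \<noteq> r" "?p \<noteq> r" "?q \<noteq> ?p" "?q < N" "?p < N" by blast+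
  have p: "r = (j + 1) mod N \<longleftrightarrow> j = ?p" if "j < N" for j
    using that assms(2) by (cases "j + 1 = N"; cases "r = 0") auto
  have "(\<Sum>j<N. cartan_A N r j * x j) = (\<Sum>j<N. (if j = r then 2 * x j else 0)
      - (if j = ?q then x j else 0) - (if j = ?p then x j else 0))"
  proof (rule sum.cong)
    fix j assume "j \<in> {..<N}"
    then have "j < N" by simp
    have "cartan_A N r j = (if r = j then 2 else if j = ?q \<or> j = ?p then - 1 else 0)"
      unfolding cartan_A_def p[OF \<open>j < N\<close>] ..
    then show "cartan_A N r j * x j = (if j = r then 2 * x j else 0)
      - (if j = ?q then x j else 0) - (if j = ?p then x j else 0)"
      using distinct by (cases "j = r"; cases "j = ?q"; cases "j = ?p") (simp_all only: if_True if_False simp_thms, simp_all)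
  qed simp
  also have "\<dots> = (\<Sum>j<N. if j = r then 2 * x j else 0)
      - (\<Sum>j<N. if j = ?q then x j else 0) - (\<Sum>j<N. if j = ?p then x j else 0)"
    by (simp only: sum_subtractf)
  also have "\<dots> = 2 * x r - x ?q - x ?p"
    using assms(2) distinct(4,5) by (simp only: sum.delta finite_lessThan lessThan_iff if_True)
  finally show ?thesis .
qed

lemma refl_A_core_weight:
  assumes "c \<in> cores N" "3 \<le> N" "r < N"
  shows "refl_A N r (core_weight N c) = core_weight N (core_refl N r c)"
proof -
  have "(\<Sum>j<N. cartan_A N r j * Poly_Mapping.lookup (core_weight N c) (Alpha j))
    = (\<Sum>j<N. cartan_A N r j * - residue_count N c j)"
    by (rule sum.cong) (simp_all add: lookup_core_weight)
  then have co: "coroot_A N r (core_weight N c) = of_bool (r = 0) - 2 * residue_count N c r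
      + residue_count N c ((r + 1) mod N) + residue_count N c (if r = 0 then N - 1 else r - 1)"
    unfolding coroot_A_def sum_cartan_A[OF assms(2,3)] by (simp add: lookup_core_weight)
  show ?thesis
  proof (rule poly_mapping_eqI)
    fix b
    show "Poly_Mapping.lookup (refl_A N r (core_weight N c)) b
      = Poly_Mapping.lookup (core_weight N (core_refl N r c)) b"
    proof (cases b)
      case (Alpha j)
      then show ?thesis
        using residue_count_core_refl[OF assms(1,3), of j] assms(3)
        by (simp add: refl_A_def lookup_minus lookup_core_weight co)
    qed (simp add: refl_A_def lookup_minus lookup_core_weight)
  qed
qed

text \<open>Reflecting the weight subtracts the value of the coroot times the simple root, and reflecting the core
  changes the number of boxes of that residue by the same value. As the empty core has weight \<open>Lam0\<close>,
  the coefficients of the simple roots in \<open>Lam0 - w Lam0\<close> count the boxes of the core by residue.\<close>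

lemma core_act_weight:
  assumes "core_act N w c d" "c \<in> cores N" "3 \<le> N"
  shows "d \<in> cores N \<and> w (core_weight N c) = core_weight N d"
  using assms
proof (induction rule: core_act.induct)
  case (core_act_refl w c d r)
  then show ?case using refl_A_core_weight core_refl_core by auto
qed simp

section \<open>The Weyl group of type D acting on self-conjugate cores\<close>

definition act_D :: "nat \<Rightarrow> nat \<Rightarrow> nat list \<Rightarrow> nat list" where
  "act_D n i c = (if i = 0 \<or> i = n then core_refl (2 * n) i c
                  else core_refl (2 * n) i (core_refl (2 * n) (2 * n - i) c))"

lemma core_act_gen_D:
  assumes "core_act (2 * n) w c d" "i \<le> n" "0 < n"
  shows "core_act (2 * n) (gen_D n i \<circ> w) c (act_D n i d)"
proof (cases "i = 0 \<or> i = n")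
  case True
  then show ?thesis using core_act_refl[OF assms(1), of i] assms(2,3) by (auto simp: gen_D_def act_D_def)
next
  case False
  have "core_act (2 * n) (refl_A (2 * n) i \<circ> (refl_A (2 * n) (2 * n - i) \<circ> w)) c
    (core_refl (2 * n) i (core_refl (2 * n) (2 * n - i) d))"
    using assms False by (intro core_act_refl) auto
  then show ?thesis using False by (simp add: gen_D_def act_D_def o_assoc)
qed

lemma word_prod_D_simps:
  "word_prod_D n [] = id"
  "word_prod_D n (i # ws) = gen_D n i \<circ> word_prod_D n ws"
  by (simp_all add: word_prod_D_def fun_eq_iff)

lemma core_act_word_prod:
  assumes "ws \<in> lists {0..n}" "0 < n"
  shows "core_act (2 * n) (word_prod_D n ws) c (foldr (act_D n) ws c)"
  using assms(1)
proof (induction ws)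
  case Nil
  have "foldr (act_D n) [] c = c" by simp
  then show ?case using core_act_id[of "2 * n" c] by (simp only: word_prod_D_simps)
next
  case (Cons i ws)
  then have "core_act (2 * n) (gen_D n i \<circ> word_prod_D n ws) c (act_D n i (foldr (act_D n) ws c))"
    using assms(2) by (intro core_act_gen_D) auto
  moreover have "foldr (act_D n) (i # ws) c = act_D n i (foldr (act_D n) ws c)" by simp
  ultimately show ?case by (simp only: word_prod_D_simps)
qed

lemma core_act_comp:
  assumes "core_act N v d e" "core_act N w c d"
  shows "core_act N (v \<circ> w) c e"
  using assms
proof (induction rule: core_act.induct)
  case (core_act_refl v d e r)
  then have "core_act N (refl_A N r \<circ> (v \<circ> w)) c (core_refl N r e)"
    by (intro core_act.core_act_refl)
  then show ?case by (simp only: o_assoc)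
qed simp

lemma word_prod_append: "word_prod_D n (us @ ws) = word_prod_D n us \<circ> word_prod_D n ws"
  by (induction us) (simp_all add: word_prod_D_simps o_assoc)

text \<open>Positions in the residue classes of \<open>i\<close> and \<open>- i\<close>. As \<open>2 * n\<close> is even, two neighbouring
  positions cannot both be of this kind, so that the reflections in \<open>i\<close> and \<open>- i\<close> combine to a
  single exchange of neighbours that commutes with conjugation.\<close>

definition mirror_pos :: "nat \<Rightarrow> nat \<Rightarrow> int \<Rightarrow> bool" where
  "mirror_pos n i k \<longleftrightarrow> 2 * int n dvd k - int i \<or> 2 * int n dvd k + int i"

definition fold_pos :: "nat \<Rightarrow> nat \<Rightarrow> int \<Rightarrow> int" where
  "fold_pos n i k = (if mirror_pos n i k then k - 1
                     else if mirror_pos n i (k + 1) then k + 1 else k)"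

lemma even_sum_of_multiples:
  assumes "2 * int n dvd a" "2 * int n dvd b"
  shows "even (a + b)"
proof -
  have "even a" "even b" using assms by (auto elim: dvd_mult_left)
  then show ?thesis by simp
qed

lemma mirror_pos_succ:
  assumes "mirror_pos n i k"
  shows "\<not> mirror_pos n i (k + 1)"
proof
  assume "mirror_pos n i (k + 1)"
  then obtain a b where ab: "a \<in> {k - int i, k + int i}" "b \<in> {k + 1 - int i, k + 1 + int i}"
    "2 * int n dvd a" "2 * int n dvd b"
    using assms unfolding mirror_pos_def by blast
  then have "odd (a + b)" by auto
  then show False using even_sum_of_multiples[OF ab(3,4)] by contradiction
qed

lemma mirror_pos_uminus: "mirror_pos n i (- k) = mirror_pos n i k"
proof -
  have "- k - int i = - (k + int i)" "- k + int i = - (k - int i)" by simp_all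
  then show ?thesis unfolding mirror_pos_def by (simp only: dvd_minus_iff) blast
qed

lemma fold_pos_mirror: "fold_pos n i (- 1 - k) = - 1 - fold_pos n i k"
proof -
  have "mirror_pos n i (- 1 - k) = mirror_pos n i (k + 1)"
    using mirror_pos_uminus[of n i "k + 1"] by (simp add: algebra_simps)
  moreover have "mirror_pos n i (- 1 - k + 1) = mirror_pos n i k"
    using mirror_pos_uminus[of n i k] by simp
  ultimately show ?thesis using mirror_pos_succ[of n i k] by (simp add: fold_pos_def)
qed

lemma fold_pos_fold_pos: "fold_pos n i (fold_pos n i k) = k"
  using mirror_pos_succ[of n i k] mirror_pos_succ[of n i "k - 1"] by (auto simp: fold_pos_def)

lemma mod_eq_iff_dvd:
  fixes k :: int
  assumes "r < 2 * n"
  shows "k mod int (2 * n) = int r \<longleftrightarrow> 2 * int n dvd k - int r"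
proof -
  have "int r mod int (2 * n) = int r" using assms by (intro mod_pos_pos_trivial) simp_all
  then have "k mod int (2 * n) = int r \<longleftrightarrow> k mod int (2 * n) = int r mod int (2 * n)" by (simp only:)
  also have "\<dots> \<longleftrightarrow> int (2 * n) dvd k - int r" by (rule mod_eq_dvd_iff)
  finally show ?thesis by (simp only: of_nat_mult of_nat_numeral)
qed

lemma mod_eq_iff_dvd_neg:
  fixes k :: int
  assumes "0 < i" "i < 2 * n"
  shows "k mod int (2 * n) = int (2 * n - i) \<longleftrightarrow> 2 * int n dvd k + int i"
proof -
  have "k + int i = (k - int (2 * n - i)) + 2 * int n" using assms by simp
  then have "2 * int n dvd k + int i \<longleftrightarrow> 2 * int n dvd k - int (2 * n - i)"
    by (simp only: dvd_add_left_iff dvd_refl)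
  moreover have "2 * n - i < 2 * n" using assms by simp
  ultimately show ?thesis using mod_eq_iff_dvd[of "2 * n - i" n k] by (simp only:)
qed

lemma not_dvd_both:
  assumes "0 < i" "i < n" "2 * int n dvd k - int i"
  shows "\<not> 2 * int n dvd k + int i"
proof
  assume "2 * int n dvd k + int i"
  then have "2 * int n dvd (k + int i) - (k - int i)" using assms(3) by (rule dvd_diff)
  then have "int n dvd int i" by simp
  then have "n \<le> i" using assms(1) by (auto dest: dvd_imp_le)
  then show False using assms(2) by simp
qed

lemma swap_pos_double:
  assumes "0 < i" "i < n"
  shows "swap_pos (2 * n) (2 * n - i) (swap_pos (2 * n) i k) = fold_pos n i k"
proof -
  have lt: "i < 2 * n" using assms by simp
  note m = mod_eq_iff_dvd[OF lt] mod_eq_iff_dvd_neg[OF assms(1) lt]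
  have A: "\<not> 2 * int n dvd x + int i" if "2 * int n dvd x - int i" for x
    using not_dvd_both[OF assms that] .
  have B: "\<not> 2 * int n dvd y + int i" if "2 * int n dvd x - int i" "y = x + 1 \<or> y = x - 1" for x y
    using even_sum_of_multiples[OF that(1), of "y + int i"] that(2) by auto
  show ?thesis
  proof (cases "2 * int n dvd k - int i")
    case True
    then show ?thesis using A[of k] B[of k "k - 1"] m[of k] m[of "k - 1"]
      by (simp add: swap_pos_def fold_pos_def mirror_pos_def)
  next
    case F: False
    show ?thesis
    proof (cases "2 * int n dvd k + 1 - int i")
      case True
      then show ?thesis
        using F A[of "k + 1"] B[of "k + 1" "2 + k"] B[of "k + 1" k] m[of k] m[of "k + 1"] m[of "2 + k"]
        by (simp add: swap_pos_def fold_pos_def mirror_pos_def)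
    next
      case False
      then show ?thesis using F m[of k] m[of "k + 1"]
        by (simp add: swap_pos_def fold_pos_def mirror_pos_def)
    qed
  qed
qed

lemma swap_pos_single:
  assumes "i = 0 \<or> i = n" "0 < n"
  shows "swap_pos (2 * n) i k = fold_pos n i k"
proof -
  have lt: "i < 2 * n" using assms by auto
  have "mirror_pos n i k \<longleftrightarrow> 2 * int n dvd k - int i" for k
  proof -
    have "2 * int n dvd k + int i \<longleftrightarrow> 2 * int n dvd k - int i"
      using assms dvd_add_right_iff[of "2 * int n" "2 * int n" "k - int n"]
      by (auto simp: algebra_simps)
    then show ?thesis by (simp add: mirror_pos_def)
  qed
  then show ?thesis using mod_eq_iff_dvd[OF lt] by (simp add: swap_pos_def fold_pos_def)
qed

lemma act_D_core:
  assumes "c \<in> cores (2 * n)" "0 < n"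
  shows "act_D n i c \<in> cores (2 * n)"
  using core_refl_core assms by (simp add: act_D_def)

lemma beta_act_D:
  assumes "c \<in> cores (2 * n)" "i \<le> n" "0 < n"
  shows "k \<in> beta (act_D n i c) \<longleftrightarrow> fold_pos n i k \<in> beta c"
proof -
  have N: "2 \<le> 2 * n" using assms(3) by simp
  show ?thesis
    using beta_core_refl[OF assms(1) N] beta_core_refl[OF core_refl_core[OF assms(1) N] N]
      swap_pos_single[of i n k] swap_pos_double[of i n k] assms by (simp add: act_D_def)
qed

lemma sc_cores_iff:
  "c \<in> sc_cores N \<longleftrightarrow> c \<in> cores N \<and> (\<forall>k. k \<in> beta c \<longleftrightarrow> - 1 - k \<notin> beta c)"
  using conjugate_eq_iff core_partition by (auto simp: sc_cores_def)

lemma act_D_sc_core: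
  assumes "c \<in> sc_cores (2 * n)" "i \<le> n" "0 < n"
  shows "act_D n i c \<in> sc_cores (2 * n)"
proof -
  have c: "c \<in> cores (2 * n)" "\<And>k. k \<in> beta c \<longleftrightarrow> - 1 - k \<notin> beta c"
    using assms(1) unfolding sc_cores_iff by blast+
  have "k \<in> beta (act_D n i c) \<longleftrightarrow> - 1 - k \<notin> beta (act_D n i c)" for k
    unfolding beta_act_D[OF c(1) assms(2,3)] fold_pos_mirror using c(2) by blast
  then show ?thesis unfolding sc_cores_iff using act_D_core[OF c(1) assms(3)] by blast
qed

lemma act_D_act_D:
  assumes "c \<in> cores (2 * n)" "i \<le> n" "0 < n"
  shows "act_D n i (act_D n i c) = c"
proof (rule beta_inj)
  show "beta (act_D n i (act_D n i c)) = beta c"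
    using beta_act_D[OF act_D_core[OF assms(1,3)] assms(2,3)] beta_act_D[OF assms]
      fold_pos_fold_pos by auto
qed (use assms act_D_core core_partition in blast)+

lemma card_boxes_core_refl:
  assumes "is_partition c" "k \<in> beta c" "k - 1 \<notin> beta c" "k mod int N = int r"
  shows "card (boxes (core_refl N r c)) < card (boxes c)"
proof -
  have "removable N r c \<noteq> {}" using assms unfolding removable_beta[OF assms(1)] by auto
  moreover have "removable N r c \<subseteq> boxes c" by (auto simp: removable_def)
  ultimately have "boxes (core_refl N r c) \<subset> boxes c" unfolding boxes_core_refl[OF assms(1)] by auto
  then show ?thesis by (rule psubset_card_mono[OF finite_boxes])
qed

lemma exists_corner:
  assumes "is_partition c" "c \<noteq> []"
  obtains k where "k \<in> beta c" "k - 1 \<notin> beta c"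
proof -
  define l where "l = length c"
  have l: "1 \<le> l" using assms(2) by (cases c) (auto simp: l_def)
  have "c ! (l - 1) \<in> set c" using l by (auto simp: l_def)
  then have "c ! (l - 1) \<noteq> 0" using assms(1) unfolding is_partition_def by metis
  then have pos: "0 < part c l" using l by (simp add: part_def l_def)
  have "int (part c l) - int l - 1 \<noteq> int (part c i) - int i" if "1 \<le> i" for i
  proof (cases "i \<le> l")
    case True
    then show ?thesis using part_antimono[OF assms(1) that True] by simp
  next
    case False
    then have "part c i = 0" by (simp add: part_def l_def)
    then show ?thesis using False pos by simp
  qed
  then have "int (part c l) - int l - 1 \<notin> beta c" by (auto simp: beta_def)
  moreover have "int (part c l) - int l \<in> beta c" using l by (auto simp: beta_def)
  ultimately show ?thesis using that by blast
qed

text \<open>Conjugation takes a removable box of content \<open>k\<close> to one of content \<open>- k\<close>. Removing the boxes of one of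
  these residues does not disturb the others, as the two residues are equal or not adjacent.\<close>

lemma act_D_decreases:
  assumes "c \<in> sc_cores (2 * n)" "c \<noteq> []" "0 < n"
  obtains i where "i \<le> n" "card (boxes (act_D n i c)) < card (boxes c)"
proof -
  have c: "c \<in> cores (2 * n)" "\<And>k. k \<in> beta c \<longleftrightarrow> - 1 - k \<notin> beta c"
    using assms(1) unfolding sc_cores_iff by blast+
  have p: "is_partition c" using c(1) by (rule core_partition)
  obtain k0 where k0: "k0 \<in> beta c" "k0 - 1 \<notin> beta c" using exists_corner[OF p assms(2)] .
  have mirror: "- k \<in> beta c \<and> - k - 1 \<notin> beta c" if "k \<in> beta c" "k - 1 \<notin> beta c" for k
  proof -
    have e: "- 1 - k = - k - 1" "- 1 - (k - 1) = - k" by simp_all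
    show ?thesis using that c(2)[of k] c(2)[of "k - 1"] unfolding e by blast
  qed
  have N: "0 < int (2 * n)" using assms(3) by simp
  obtain k where k: "k \<in> beta c" "k - 1 \<notin> beta c" "k mod int (2 * n) \<le> int n"
  proof (cases "k0 mod int (2 * n) \<le> int n")
    case True
    then show ?thesis using that k0 by blast
  next
    case False
    have "- k0 mod int (2 * n) = int (2 * n) - k0 mod int (2 * n)"
      using False N by (subst zmod_zminus1_eq_if) auto
    then show ?thesis using that[of "- k0"] mirror[OF k0] False by simp
  qed
  define i where "i = nat (k mod int (2 * n))"
  have i: "i \<le> n" "k mod int (2 * n) = int i"
    using k(3) pos_mod_sign[OF N, of k] by (auto simp: i_def)
  show ?thesis
  proof (rule that[OF i(1)])
    show "card (boxes (act_D n i c)) < card (boxes c)"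
    proof (cases "i = 0 \<or> i = n")
      case True
      then show ?thesis using card_boxes_core_refl[OF p k(1,2) i(2)] by (auto simp: act_D_def)
    next
      case False
      then have i': "0 < i" "i < n" "i < 2 * n" using i(1) by auto
      note m = mod_eq_iff_dvd[OF i'(3)] mod_eq_iff_dvd_neg[OF i'(1,3)]
      let ?c = "core_refl (2 * n) (2 * n - i) c"
      have ki: "2 * int n dvd k - int i" using i(2) m by simp
      have "\<not> 2 * int n dvd y + int i" if "y = k + 1 \<or> y = k - 1" for y
        using even_sum_of_multiples[OF ki, of "y + int i"] that by auto
      then have "swap_pos (2 * n) (2 * n - i) k = k" "swap_pos (2 * n) (2 * n - i) (k - 1) = k - 1"
        using not_dvd_both[OF i'(1,2) ki] m(2)[of k] m(2)[of "k - 1"] m(2)[of "k + 1"]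
        by (simp_all add: swap_pos_def)
      then have "k \<in> beta ?c" "k - 1 \<notin> beta ?c"
        using beta_core_refl[OF c(1)] k i' by simp_all
      then have "card (boxes (core_refl (2 * n) i ?c)) < card (boxes ?c)"
        using card_boxes_core_refl[OF is_partition_core_refl[OF p] _ _ i(2)] by blast
      moreover have "- k mod int (2 * n) = int (2 * n - i)"
      proof -
        have "- k + int i = - (k - int i)" by simp
        then show ?thesis using ki m(2)[of "- k"] by (simp only: dvd_minus_iff)
      qed
      then have "card (boxes ?c) < card (boxes c)"
        using card_boxes_core_refl[OF p _ _] mirror[OF k(1,2)] by blast
      ultimately show ?thesis using False by (simp add: act_D_def)
    qed
  qed
qed

text \<open>Generators lead from any self-conjugate core down to the empty one, and they are involutions.\<close>

lemma core_act_transitive: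
  assumes "c \<in> sc_cores (2 * n)" "0 < n"
  shows "\<exists>w\<in>W_D n. core_act (2 * n) w [] c"
  using assms(1)
proof (induction "card (boxes c)" arbitrary: c rule: less_induct)
  case less
  show ?case
  proof (cases "c = []")
    case True
    have "id \<in> W_D n" unfolding W_D_def by (rule image_eqI[of _ _ "[]"]) (simp_all add: word_prod_D_simps)
    then show ?thesis using True core_act_id by blast
  next
    case False
    then obtain i where i: "i \<le> n" "card (boxes (act_D n i c)) < card (boxes c)"
      using act_D_decreases[OF less.prems _ assms(2)] by blast
    then obtain w where w: "w \<in> W_D n" "core_act (2 * n) w [] (act_D n i c)"
      using less.hyps act_D_sc_core[OF less.prems _ assms(2)] by blast
    have c: "c \<in> cores (2 * n)" using less.prems by (simp add: sc_cores_iff)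
    have "core_act (2 * n) (gen_D n i \<circ> w) [] c"
      using core_act_gen_D[OF w(2) i(1) assms(2)] act_D_act_D[OF c i(1) assms(2)] by simp
    moreover obtain ws where "ws \<in> lists {0..n}" "w = word_prod_D n ws"
      using w(1) unfolding W_D_def by blast
    then have "gen_D n i \<circ> w = word_prod_D n (i # ws)" "i # ws \<in> lists {0..n}"
      using i(1) by (auto simp: word_prod_D_simps)
    then have "gen_D n i \<circ> w \<in> W_D n" unfolding W_D_def by blast
    ultimately show ?thesis by blast
  qed
qed

section \<open>The atomic length counts boxes\<close>

lemma beta_Nil: "beta [] = {k. k < 0}"
proof -
  have "k \<in> beta []" if "k < 0" for k :: int
    using that unfolding beta_def by (intro CollectI exI[of _ "nat (- k)"]) (auto simp: part_def)
  moreover have "k < 0" if "k \<in> beta []" for k :: int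
    using that by (auto simp: beta_def part_def)
  ultimately show ?thesis by blast
qed

lemma boxes_Nil: "boxes [] = {}"
  by (auto simp: boxes_def part_def)

lemma Nil_core: "0 < N \<Longrightarrow> [] \<in> cores N"
  by (simp add: cores_def is_partition_def boxes_Nil)

lemma core_refl_Nil:
  assumes "0 < r"
  shows "core_refl N r [] = []"
proof -
  have p: "is_partition []" by (simp add: is_partition_def)
  have "k - 1 \<in> beta [] \<and> k \<notin> beta [] \<Longrightarrow> k = 0" for k by (auto simp: beta_Nil)
  then have "addable N r [] = {}" using assms unfolding addable_beta[OF p] by fastforce
  moreover have "removable N r [] = {}" by (auto simp: removable_def boxes_Nil)
  ultimately show ?thesis by (simp add: core_refl_def)
qed

lemma W_D_fin_fixes_Nil:
  assumes "u \<in> W_D_fin n" "0 < n"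
  shows "core_act (2 * n) u [] []"
proof -
  obtain ws where ws: "ws \<in> lists {1..n}" "u = word_prod_D n ws"
    using assms(1) unfolding W_D_fin_def by blast
  have "foldr (act_D n) ws [] = []"
    using ws(1) assms(2) by (induction ws) (auto simp: act_D_def core_refl_Nil)
  moreover have "ws \<in> lists {0..n}" using ws(1) by auto
  ultimately show ?thesis using core_act_word_prod[of ws n "[]"] assms(2) ws(2) by metis
qed

text \<open>An element of minimal length in the coset of \<open>w\<close> still maps the empty core to the same
  core, as the finite subgroup fixes the empty core.\<close>

lemma grassmannian_representative:
  assumes "c \<in> sc_cores (2 * n)" "0 < n"
  shows "\<exists>w\<in>grassmannian_D n. core_act (2 * n) w [] c"
proof -
  obtain w where w: "w \<in> W_D n" "core_act (2 * n) w [] c"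
    using core_act_transitive[OF assms] by blast
  have id: "id \<in> W_D_fin n"
    unfolding W_D_fin_def by (rule image_eqI[of _ _ "[]"]) (simp_all add: word_prod_D_simps)
  obtain u where u: "u \<in> W_D_fin n"
    and min: "\<And>u'. u' \<in> W_D_fin n \<Longrightarrow> length_D n (w \<circ> u) \<le> length_D n (w \<circ> u')"
    using ex_has_least_nat[of "\<lambda>u. u \<in> W_D_fin n" id "\<lambda>u. length_D n (w \<circ> u)"] id by blast
  have closed: "u1 \<circ> u2 \<in> W_D_fin n" if u12: "u1 \<in> W_D_fin n" "u2 \<in> W_D_fin n" for u1 u2
  proof -
    obtain ws1 ws2 where "ws1 \<in> lists {1..n}" "u1 = word_prod_D n ws1"
      "ws2 \<in> lists {1..n}" "u2 = word_prod_D n ws2"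
      using u12 unfolding W_D_fin_def by blast
    then show ?thesis unfolding W_D_fin_def
      by (intro image_eqI[of _ _ "ws1 @ ws2"]) (auto simp: word_prod_append)
  qed
  have "w \<circ> u \<in> W_D n"
  proof -
    obtain ws1 ws2 where "ws1 \<in> lists {0..n}" "w = word_prod_D n ws1"
      "ws2 \<in> lists {1..n}" "u = word_prod_D n ws2"
      using u w(1) unfolding W_D_fin_def W_D_def by blast
    then show ?thesis unfolding W_D_def
      by (intro image_eqI[of _ _ "ws1 @ ws2"]) (auto simp: word_prod_append)
  qed
  then have "w \<circ> u \<in> grassmannian_D n"
    using min closed[OF u] by (auto simp: grassmannian_D_def o_assoc[symmetric])
  moreover have "core_act (2 * n) (w \<circ> u) [] c"
    using core_act_comp[OF w(2) W_D_fin_fixes_Nil[OF u assms(2)]] .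
  ultimately show ?thesis by blast
qed

lemma boxes_self_conjugate:
  assumes "is_partition c" "conjugate c = c"
  shows "(i, j) \<in> boxes c \<longleftrightarrow> (j, i) \<in> boxes c"
  using le_part_iff[OF assms(1), of i j] assms(2) by (auto simp: boxes_def)

lemma residue_count_mirror:
  assumes "is_partition c" "conjugate c = c" "0 < i" "i < 2 * n"
  shows "residue_count (2 * n) c (2 * n - i) = residue_count (2 * n) c i"
proof -
  have "bij_betw (\<lambda>(a, b). (b, a)) {b \<in> boxes c. residue (2 * n) b = int (2 * n - i)}
    {b \<in> boxes c. residue (2 * n) b = int i}"
  proof (rule bij_betw_byWitness[of _ "\<lambda>(a, b). (b, a)"])
    have eq: "residue (2 * n) (a, b) = int (2 * n - i) \<longleftrightarrow> residue (2 * n) (b, a) = int i" for a b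
    proof -
      have "int b - int a + int i = - (int a - int b - int i)" by simp
      then show ?thesis unfolding residue_content fst_conv snd_conv
        mod_eq_iff_dvd_neg[OF assms(3,4)] mod_eq_iff_dvd[OF assms(4)]
        by (simp only: dvd_minus_iff)
    qed
    show "(\<lambda>(a, b). (b, a)) ` {b \<in> boxes c. residue (2 * n) b = int (2 * n - i)}
      \<subseteq> {b \<in> boxes c. residue (2 * n) b = int i}"
      using boxes_self_conjugate[OF assms(1,2)] eq by auto
    show "(\<lambda>(a, b). (b, a)) ` {b \<in> boxes c. residue (2 * n) b = int i}
      \<subseteq> {b \<in> boxes c. residue (2 * n) b = int (2 * n - i)}"
      using boxes_self_conjugate[OF assms(1,2)] eq by auto
  qed auto
  then show ?thesis unfolding residue_count_def by (simp add: bij_betw_same_card)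
qed

lemma lookup_sum_alpha_D:
  fixes a :: "nat \<Rightarrow> int"
  assumes "0 < n"
  shows "Poly_Mapping.lookup (\<Sum>i\<le>n. frag_cmul (a i) (alpha_D n i)) Lam0 = 0"
    and "Poly_Mapping.lookup (\<Sum>i\<le>n. frag_cmul (a i) (alpha_D n i)) (Alpha j)
      = (if j \<le> n then a j else if j < 2 * n then a (2 * n - j) else 0)"
proof -
  show "Poly_Mapping.lookup (\<Sum>i\<le>n. frag_cmul (a i) (alpha_D n i)) Lam0 = 0"
    by (auto simp: lookup_sum alpha_D_def lookup_add intro: sum.neutral)
  have "Poly_Mapping.lookup (\<Sum>i\<le>n. frag_cmul (a i) (alpha_D n i)) (Alpha j)
    = (\<Sum>i\<le>n. if i = (if j \<le> n then j else 2 * n - j) then if j < 2 * n then a i else 0 else 0)"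
    unfolding lookup_sum
    by (rule sum.cong) (use assms in \<open>auto simp: alpha_D_def lookup_add\<close>)
  then show "Poly_Mapping.lookup (\<Sum>i\<le>n. frag_cmul (a i) (alpha_D n i)) (Alpha j)
      = (if j \<le> n then a j else if j < 2 * n then a (2 * n - j) else 0)"
    using assms by auto
qed

lemma core_weight_Nil: "core_weight N [] = frag_of Lam0"
  by (simp add: core_weight_def residue_count_def boxes_Nil)

text \<open>For every representative \<open>w\<close> the weight \<open>w Lam0\<close> is the weight of the core, so the coefficients are
  forced to be the residue counts \<open>0, \<dots>, n\<close>. That these do express \<open>Lam0 - w Lam0\<close> in the roots of
  type \<open>D\<close> is due to the symmetry of the residue counts of a self-conjugate core.\<close>

lemma L_D_eq:
  assumes "c \<in> sc_cores (2 * n)" "2 \<le> n"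
  shows "L_D n c = (\<Sum>i\<le>n. residue_count (2 * n) c i)"
proof -
  have c: "c \<in> cores (2 * n)" "is_partition c" "conjugate c = c"
    using assms(1) core_partition by (auto simp: sc_cores_def)
  have n: "0 < n" "3 \<le> 2 * n" "0 < 2 * n" using assms(2) by auto
  let ?b = "residue_count (2 * n) c"
  have weight: "w (frag_of Lam0) = core_weight (2 * n) c" if "core_act (2 * n) w [] c" for w
    using core_act_weight[OF that Nil_core[OF n(3)] n(2)] by (simp add: core_weight_Nil)
  show ?thesis unfolding L_D_def
  proof (rule the_equality)
    obtain w where w: "w \<in> grassmannian_D n" "core_act (2 * n) w [] c"
      using grassmannian_representative[OF assms(1) n(1)] by blast
    have "frag_of Lam0 - w (frag_of Lam0) = (\<Sum>i\<le>n. frag_cmul (?b i) (alpha_D n i))"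
    proof (rule poly_mapping_eqI)
      fix x
      show "Poly_Mapping.lookup (frag_of Lam0 - w (frag_of Lam0)) x
        = Poly_Mapping.lookup (\<Sum>i\<le>n. frag_cmul (?b i) (alpha_D n i)) x"
      proof (cases x)
        case Lam0
        then show ?thesis
          by (simp add: weight[OF w(2)] lookup_minus lookup_core_weight lookup_sum_alpha_D[OF n(1)])
      next
        case (Alpha j)
        have "?b j = ?b (2 * n - j)" if "n < j" "j < 2 * n"
          using residue_count_mirror[OF c(2,3), of j n] that by simp
        then show ?thesis using Alpha n(1)
          by (simp add: weight[OF w(2)] lookup_minus lookup_core_weight lookup_sum_alpha_D[OF n(1)])
      qed
    qed
    then show "\<exists>w\<in>grassmannian_D n. \<exists>a. core_act (2 * n) w [] c
      \<and> frag_of Lam0 - w (frag_of Lam0) = (\<Sum>i\<le>n. frag_cmul (a i) (alpha_D n i))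
      \<and> (\<Sum>i\<le>n. ?b i) = (\<Sum>i\<le>n. a i)"
      using w by blast
  next
    fix l
    assume "\<exists>w\<in>grassmannian_D n. \<exists>a. core_act (2 * n) w [] c
      \<and> frag_of Lam0 - w (frag_of Lam0) = (\<Sum>i\<le>n. frag_cmul (a i) (alpha_D n i))
      \<and> l = (\<Sum>i\<le>n. a i)"
    then obtain w a where w: "core_act (2 * n) w [] c"
      and a: "frag_of Lam0 - w (frag_of Lam0) = (\<Sum>i\<le>n. frag_cmul (a i) (alpha_D n i))"
      and l: "l = (\<Sum>i\<le>n. a i)" by blast
    have "a i = ?b i" if "i \<le> n" for i
      using arg_cong[OF a, of "\<lambda>v. Poly_Mapping.lookup v (Alpha i)"] that n(1)
      by (simp add: weight[OF w] lookup_minus lookup_core_weight lookup_sum_alpha_D[OF n(1)])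
    then show "l = (\<Sum>i\<le>n. ?b i)" unfolding l by simp
  qed
qed

section \<open>The atomic length as a sum over beads\<close>

definition pos_beads :: "nat list \<Rightarrow> nat set" where
  "pos_beads c = {s. int s \<in> beta c}"

text \<open>For \<open>n > 0\<close> this is the increasing enumeration, from 0 on, of the positive integers that are not
  multiples of \<open>n + 1\<close>.\<close>

definition stretch :: "nat \<Rightarrow> nat \<Rightarrow> nat" where
  "stretch n s = s + 1 + s div n"

lemma sum_symmetric_window:
  fixes h :: "int \<Rightarrow> int"
  shows "(\<Sum>k\<in>{- int M..int M}. h k) = h 0 + (\<Sum>k=1..M. h (int k) + h (- int k))"
proof (induction M)
  case (Suc M)
  have "{- int (Suc M)..int (Suc M)} = insert (int (Suc M)) (insert (- int (Suc M)) {- int M..int M})"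
    by auto
  then show ?case using Suc by simp
qed simp

lemma diag_eq_sum:
  assumes "is_partition c" "part c 1 \<le> M" "k \<le> Suc M"
  shows "int (diag c (int k)) = (\<Sum>j=k..M. of_bool (int j \<in> beta c))"
  using assms(3)
proof (induction rule: inc_induct)
  case base
  have "diag c (int (Suc M)) = 0" using diag_eq_0[OF _ assms(1)] assms(2) by simp
  then show ?case by simp
next
  case (step k)
  then have "{k..M} = insert k {Suc k..M}" by auto
  then have "(\<Sum>j=k..M. of_bool (int j \<in> beta c) :: int)
    = of_bool (int k \<in> beta c) + (\<Sum>j=Suc k..M. of_bool (int j \<in> beta c))"
    by (simp only: sum.insert finite_atLeastAtMost atLeastAtMost_iff) simp
  moreover have e: "int k + 1 = int (Suc k)" by simp
  have "int (diag c (int k)) = of_bool (int k \<in> beta c) + int (diag c (int (Suc k)))"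
    using diag_step[OF assms(1), of "int k", unfolded e] by simp
  ultimately show ?case by (simp only: step.IH)
qed

lemma sum_triangle_swap:
  fixes g b :: "nat \<Rightarrow> int"
  shows "(\<Sum>k\<le>M. g k * (\<Sum>j=k..M. b j)) = (\<Sum>j\<le>M. b j * (\<Sum>k\<le>j. g k))"
proof (induction M)
  case (Suc M)
  have "(\<Sum>k\<le>M. g k * (\<Sum>j=k..Suc M. b j)) = (\<Sum>k\<le>M. g k * (\<Sum>j=k..M. b j) + g k * b (Suc M))"
    by (rule sum.cong) (simp_all add: algebra_simps)
  then show ?case using Suc by (simp add: sum.distrib sum_distrib_left distrib_left mult.commute[of _ "b (Suc M)"])
qed simp

text \<open>The summand is the number of times that a box on diagonal \<open>k\<close> counts when the diagonals of contents
  \<open>k\<close> and \<open>- k\<close> are taken together.\<close>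

lemma sum_stretch:
  assumes "0 < n"
  shows "(\<Sum>k\<le>s. if k = 0 then 1 else 1 + of_bool (n dvd k)) = int (stretch n s)"
proof (induction s)
  case (Suc s)
  have "Suc s div n = s div n + of_bool (n dvd Suc s)"
    using assms by (auto simp: div_Suc dvd_eq_mod_eq_0)
  then show ?case using Suc by (simp add: stretch_def)
qed (simp add: stretch_def)

text \<open>The diagonals of contents \<open>k\<close> and \<open>- k\<close> have the same length. Exactly one of the two has its residue in
  \<open>0, \<dots>, n\<close>, unless \<open>n\<close> divides \<open>k\<close>, when both have. So a box on diagonal \<open>k \<ge> 0\<close> counts once, or
  twice if \<open>k > 0\<close> and \<open>n\<close> divides \<open>k\<close>. Since the length of diagonal \<open>k \<ge> 0\<close> is the number of beads at
  or to the right of \<open>k\<close>, a bead \<open>s \<ge> 0\<close> is responsible for one box on each of the diagonals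
  \<open>0, \<dots>, s\<close>, and the weights of these boxes add up to \<open>s + 1 + s div n\<close>.\<close>

lemma sum_residue_counts:
  assumes "is_partition c" "conjugate c = c" "0 < n"
  shows "(\<Sum>i\<le>n. residue_count (2 * n) c i) = (\<Sum>s\<in>pos_beads c. int (stretch n s))"
proof -
  define M where "M = max (length c) (part c 1)"
  have M: "length c \<le> M" "part c 1 \<le> M" by (auto simp: M_def)
  have N: "0 < 2 * int n" using assms(3) by simp
  define f where "f k = (of_bool (k mod (2 * int n) \<le> int n) :: int)" for k
  have f: "(\<Sum>i\<le>n. of_bool (k mod int (2 * n) = int i)) = f k" for k
  proof -
    define r where "r = nat (k mod int (2 * n))"
    have r: "k mod int (2 * n) = int r" using N by (simp add: r_def)
    have "(\<Sum>i\<le>n. of_bool (k mod int (2 * n) = int i)) = (\<Sum>i\<le>n. if i = r then 1 else 0 :: int)"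
      unfolding r by (rule sum.cong) auto
    then show ?thesis using r by (simp add: f_def)
  qed
  have f_sum: "f k + f (- k) = 1 + of_bool (int n dvd k)" for k
  proof -
    define r where "r = k mod (2 * int n)"
    have r: "0 \<le> r" "r < 2 * int n" using N by (auto simp: r_def)
    have neg: "- k mod (2 * int n) = (if r = 0 then 0 else 2 * int n - r)"
      unfolding r_def by (simp add: zmod_zminus1_eq_if)
    have "int n dvd k \<longleftrightarrow> int n dvd r" unfolding r_def by (metis dvd_mod_iff dvd_triv_right)
    also have "\<dots> \<longleftrightarrow> r = 0 \<or> r = int n"
    proof
      assume "int n dvd r"
      then obtain q where q: "r = int n * q" by (rule dvdE)
      have "0 \<le> q" using q r(1) assms(3) by (simp add: zero_le_mult_iff)
      moreover have "int n * q < int n * 2" using q r(2) by simp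
      then have "q < 2" using assms(3) by (simp only: mult_less_cancel_left_pos of_nat_0_less_iff)
      ultimately have "q = 0 \<or> q = 1" by linarith
      then show "r = 0 \<or> r = int n" using q by auto
    qed auto
    finally show ?thesis unfolding f_def neg r_def[symmetric] using r assms(3) by auto
  qed
  have mirror: "diag c (- k) = diag c k" for k
  proof -
    have "bij_betw (\<lambda>(a, b). (b, a)) {b \<in> boxes c. content b = - k} {b \<in> boxes c. content b = k}"
      by (rule bij_betw_byWitness[of _ "\<lambda>(a, b). (b, a)"])
        (use boxes_self_conjugate[OF assms(1,2)] in auto)
    then show ?thesis unfolding diag_def by (rule bij_betw_same_card)
  qed
  define g where "g k = (if k = 0 then 1 else 1 + of_bool (n dvd k) :: int)" for k
  have "(\<Sum>i\<le>n. residue_count (2 * n) c i)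
    = (\<Sum>i\<le>n. \<Sum>k\<in>{- int M..int M}. of_bool (k mod int (2 * n) = int i) * int (diag c k))"
    using M by (simp only: residue_count_diag[OF assms(1), of "int M"] of_nat_le_iff)
  also have "\<dots> = (\<Sum>k\<in>{- int M..int M}. f k * int (diag c k))"
    by (subst sum.swap) (simp only: sum_distrib_right[symmetric] f)
  also have "\<dots> = f 0 * int (diag c 0)
      + (\<Sum>k=1..M. f (int k) * int (diag c (int k)) + f (- int k) * int (diag c (- int k)))"
    by (rule sum_symmetric_window)
  also have "\<dots> = g 0 * int (diag c (int 0)) + (\<Sum>k=1..M. g k * int (diag c (int k)))"
  proof -
    have "f (int k) * int (diag c (int k)) + f (- int k) * int (diag c (- int k))
      = g k * int (diag c (int k))" if "k \<in> {1..M}" for k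
    proof -
      have "g k = f (int k) + f (- int k)" using that unfolding f_sum by (simp add: g_def)
      then show ?thesis by (simp add: mirror algebra_simps)
    qed
    moreover have "f 0 = g 0" by (simp add: f_def g_def)
    ultimately show ?thesis by simp
  qed
  also have "\<dots> = (\<Sum>k\<le>M. g k * int (diag c (int k)))"
  proof -
    have "{..M} = insert 0 {1..M}" by auto
    then show ?thesis by simp
  qed
  also have "\<dots> = (\<Sum>k\<le>M. g k * (\<Sum>j=k..M. of_bool (int j \<in> beta c)))"
    by (rule sum.cong) (simp_all add: diag_eq_sum[OF assms(1) M(2)])
  also have "\<dots> = (\<Sum>j\<le>M. of_bool (int j \<in> beta c) * int (stretch n j))"
    unfolding sum_triangle_swap g_def sum_stretch[OF assms(3)] ..
  also have "\<dots> = (\<Sum>s\<in>pos_beads c. int (stretch n s))"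
  proof (rule sum.mono_neutral_cong_right)
    show "pos_beads c \<subseteq> {..M}"
      using beta_bounds(1)[OF assms(1)] M(2) by (fastforce simp: pos_beads_def)
  qed (auto simp: pos_beads_def)
  finally show ?thesis .
qed

lemma finite_pos_beads:
  assumes "is_partition c"
  shows "finite (pos_beads c)"
proof -
  have "pos_beads c \<subseteq> {..part c 1}"
    using beta_bounds(1)[OF assms] by (fastforce simp: pos_beads_def)
  then show ?thesis by (rule finite_subset) simp
qed

section \<open>Doubled distinct partitions\<close>

lemma distinct_partition_step:
  assumes "lam \<in> distinct_partitions" "1 \<le> i" "i < length lam"
  shows "part lam (Suc i) < part lam i"
proof -
  have "sorted_wrt (>) lam" using assms(1) by (simp add: distinct_partitions_def)
  then have "lam ! i < lam ! (i - 1)"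
    using sorted_wrt_nth_less[of "(>)" lam "i - 1" i] assms(2,3) by simp
  then show ?thesis using assms(2,3) by (simp add: part_def)
qed

lemma shifted_row_end_antimono:
  assumes "lam \<in> distinct_partitions" "1 \<le> i" "i \<le> i'" "i' \<le> length lam"
  shows "i' + part lam i' \<le> i + part lam i"
  using assms(3,4)
proof (induction rule: dec_induct)
  case (step m)
  then show ?case using distinct_partition_step[OF assms(1), of m] assms(2) by simp
qed simp

lemma shifted_row_end:
  assumes "lam \<in> distinct_partitions" "1 \<le> i" "i \<le> length lam"
  shows "length lam < i + part lam i"
proof -
  have "lam ! (length lam - 1) \<in> set lam" using assms by (intro nth_mem) linarith
  then have "lam ! (length lam - 1) \<noteq> 0" using assms(1) unfolding distinct_partitions_def
    by (metis (mono_tags, lifting) mem_Collect_eq)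
  then have "0 < part lam (length lam)" using assms by (simp add: part_def)
  then show ?thesis using shifted_row_end_antimono[OF assms(1,2,3)] by simp
qed

lemma shifted_column:
  assumes "lam \<in> distinct_partitions"
  shows "{i. (i, j) \<in> shifted_boxes lam} = {1..card {i. (i, j) \<in> shifted_boxes lam}}"
proof (rule initial_segment)
  show "finite {i. (i, j) \<in> shifted_boxes lam}"
    by (rule finite_subset[of _ "{..length lam}"]) (auto simp: shifted_boxes_def)
  fix i i' assume i: "i \<in> {i. (i, j) \<in> shifted_boxes lam}" "1 \<le> i'" "i' \<le> i"
  then have "j \<le> i + part lam i" "i \<le> length lam" "i + 1 \<le> j" by (auto simp: shifted_boxes_def)
  then show "i' \<in> {i. (i, j) \<in> shifted_boxes lam}"
    using shifted_row_end_antimono[OF assms i(2,3)] i(2,3) by (auto simp: shifted_boxes_def)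
qed (simp add: shifted_boxes_def)

text \<open>In the shifted diagram, column \<open>j\<close> with \<open>j \<le> length lam\<close> is full down to row \<open>j - 1\<close>, and adding
  \<open>part lam j\<close> boxes extends it to row \<open>j - 1 + part lam j\<close>. The columns further to the right remain as
  they are.\<close>

lemma mem_doubled_set:
  assumes "lam \<in> distinct_partitions" "1 \<le> i" "1 \<le> j"
  shows "i \<le> card {i'. (i', j) \<in> shifted_boxes lam} + part lam j \<longleftrightarrow>
    (if j \<le> length lam then i < j + part lam j else i \<le> length lam \<and> j \<le> i + part lam i)"
proof (cases "j \<le> length lam")
  case True
  have "{i'. (i', j) \<in> shifted_boxes lam} = {1..<j}"
    using True shifted_row_end[OF assms(1)] by (fastforce simp: shifted_boxes_def)
  then show ?thesis using True assms(2,3) by auto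
next
  case False
  have "i \<le> card {i'. (i', j) \<in> shifted_boxes lam} \<longleftrightarrow> (i, j) \<in> shifted_boxes lam"
    using eqset_imp_iff[OF shifted_column[OF assms(1), of j], of i] assms(2) by simp
  then show ?thesis using False assms(2) by (auto simp: shifted_boxes_def part_def)
qed

lemma doubled_partition:
  assumes "lam \<in> distinct_partitions"
  shows "is_partition (doubled lam)"
    and "1 \<le> i \<Longrightarrow> 1 \<le> j \<Longrightarrow> (i, j) \<in> boxes (doubled lam) \<longleftrightarrow>
      i \<le> card {i'. (i', j) \<in> shifted_boxes lam} + part lam j"
proof -
  let ?l = "length lam"
  let ?D = "{(i, j). 1 \<le> i \<and> 1 \<le> j \<and> i \<le> card {i'. (i', j) \<in> shifted_boxes lam} + part lam j}"
  have mem: "(i, j) \<in> ?D \<longleftrightarrow> 1 \<le> i \<and> 1 \<le> j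
    \<and> (if j \<le> ?l then i < j + part lam j else i \<le> ?l \<and> j \<le> i + part lam i)" for i j
    using mem_doubled_set[OF assms, of i j] by auto
  have "is_diagram ?D" unfolding is_diagram_iff
  proof (intro conjI allI impI)
    have "i \<le> ?l + Suc (part lam 1) \<and> j \<le> ?l + Suc (part lam 1)" if "(i, j) \<in> ?D" for i j
    proof (cases "j \<le> ?l")
      case True
      then show ?thesis using that shifted_row_end_antimono[OF assms, of 1 j] unfolding mem by simp
    next
      case False
      then show ?thesis using that shifted_row_end_antimono[OF assms, of 1 i] unfolding mem by simp
    qed
    then have "?D \<subseteq> {..?l + Suc (part lam 1)} \<times> {..?l + Suc (part lam 1)}" by blast
    then show "finite ?D" by (rule finite_subset) simp
    fix i j
    show "1 \<le> i" "1 \<le> j" if "(i, j) \<in> ?D" using that by auto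
    show "(i, j) \<in> ?D" if "(Suc i, j) \<in> ?D" "1 \<le> i"
      using that shifted_row_end_antimono[OF assms, of i "Suc i"] unfolding mem
      by (auto split: if_splits)
    show "(i, j) \<in> ?D" if "(i, Suc j) \<in> ?D" "1 \<le> j"
      using that shifted_row_end_antimono[OF assms, of j "Suc j"] shifted_row_end[OF assms, of j]
      unfolding mem by (auto split: if_splits)
  qed
  then have "is_partition (doubled lam)" "boxes (doubled lam) = ?D"
    unfolding doubled_def by (rule partition_of_diagram)+
  then show "is_partition (doubled lam)"
    "1 \<le> i \<Longrightarrow> 1 \<le> j \<Longrightarrow> (i, j) \<in> boxes (doubled lam) \<longleftrightarrow>
      i \<le> card {i'. (i', j) \<in> shifted_boxes lam} + part lam j" by auto
qed

lemma mem_boxes_doubled: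
  assumes "lam \<in> distinct_partitions" "1 \<le> i" "1 \<le> j"
  shows "(i, j) \<in> boxes (doubled lam) \<longleftrightarrow>
    (if j \<le> length lam then i < j + part lam j else i \<le> length lam \<and> j \<le> i + part lam i)"
  using doubled_partition(2)[OF assms] mem_doubled_set[OF assms] by simp

lemma doubled_rows:
  assumes "lam \<in> distinct_partitions" "1 \<le> i"
  shows "i \<le> length lam \<Longrightarrow> part (doubled lam) i = i + part lam i"
    and "length lam < i \<Longrightarrow> part (doubled lam) i \<le> length lam"
proof -
  have le: "j \<le> part (doubled lam) i \<longleftrightarrow> (i, j) \<in> boxes (doubled lam)" if "1 \<le> j" for j
    using that assms(2) by (simp add: boxes_def)
  show "part (doubled lam) i = i + part lam i" if i: "i \<le> length lam"
  proof (rule nat_eqI_pos)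
    fix j :: nat assume j: "1 \<le> j"
    show "j \<le> part (doubled lam) i \<longleftrightarrow> j \<le> i + part lam i"
      using shifted_row_end[OF assms(1) j] shifted_row_end[OF assms i] i
      unfolding le[OF j] mem_boxes_doubled[OF assms j] by auto
  qed
  show "part (doubled lam) i \<le> length lam" if i: "length lam < i"
  proof (rule ccontr)
    assume "\<not> part (doubled lam) i \<le> length lam"
    then show False
      using le[of "part (doubled lam) i"] mem_boxes_doubled[OF assms, of "part (doubled lam) i"] i by simp
  qed
qed

lemma doubled_columns:
  assumes "lam \<in> distinct_partitions" "1 \<le> j"
  shows "j \<le> length lam \<Longrightarrow> Suc (part (conjugate (doubled lam)) j) = j + part lam j"
    and "length lam < j \<Longrightarrow> part (conjugate (doubled lam)) j \<le> length lam"
proof -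
  have le: "i \<le> part (conjugate (doubled lam)) j \<longleftrightarrow> (i, j) \<in> boxes (doubled lam)" if "1 \<le> i" for i
    using le_part_iff[OF doubled_partition(1)[OF assms(1)] that assms(2)] that assms(2)
    by (simp add: boxes_def)
  show "Suc (part (conjugate (doubled lam)) j) = j + part lam j" if j: "j \<le> length lam"
  proof -
    have "part (conjugate (doubled lam)) j = j + part lam j - 1"
    proof (rule nat_eqI_pos)
      fix i :: nat assume i: "1 \<le> i"
      show "i \<le> part (conjugate (doubled lam)) j \<longleftrightarrow> i \<le> j + part lam j - 1"
        using j i assms(2) unfolding le[OF i] mem_boxes_doubled[OF assms(1) i assms(2)] by auto
    qed
    then show ?thesis using assms(2) by simp
  qed
  show "part (conjugate (doubled lam)) j \<le> length lam" if j: "length lam < j"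
  proof (rule ccontr)
    assume "\<not> part (conjugate (doubled lam)) j \<le> length lam"
    then show False
      using le[of "part (conjugate (doubled lam)) j"]
        mem_boxes_doubled[OF assms(1) _ assms(2), of "part (conjugate (doubled lam)) j"] j by simp
  qed
qed

lemma set_conv_part: "p \<in> set lam \<longleftrightarrow> (\<exists>i\<ge>1. i \<le> length lam \<and> p = part lam i)"
proof
  assume "p \<in> set lam"
  then obtain i where "i < length lam" "lam ! i = p" by (auto simp: in_set_conv_nth)
  then show "\<exists>i\<ge>1. i \<le> length lam \<and> p = part lam i"
    by (intro exI[of _ "Suc i"]) (simp add: part_def)
qed (auto simp: part_def)

text \<open>Row \<open>i\<close> of the doubled diagram extends \<open>part lam i\<close> boxes beyond the main diagonal, and column \<open>i\<close>
  extends one box less below it, for \<open>i \<le> length lam\<close>. So the nonnegative beads are the parts and the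
  negative gaps are the negatives of the parts.\<close>

lemma beta_doubled:
  assumes "lam \<in> distinct_partitions"
  shows "int p \<in> beta (doubled lam) \<longleftrightarrow> p \<in> set lam"
    and "0 < p \<Longrightarrow> - int p \<in> beta (doubled lam) \<longleftrightarrow> p \<notin> set lam"
proof -
  note rows = doubled_rows[OF assms] and cols = doubled_columns[OF assms]
  show "int p \<in> beta (doubled lam) \<longleftrightarrow> p \<in> set lam"
  proof
    assume "int p \<in> beta (doubled lam)"
    then obtain i where i: "1 \<le> i" "int p = int (part (doubled lam) i) - int i"
      by (auto simp: beta_def)
    then have "i \<le> length lam" using rows(2)[of i] by force
    then show "p \<in> set lam" unfolding set_conv_part using i rows(1)[of i] by auto
  next
    assume "p \<in> set lam"
    then obtain i where "1 \<le> i" "i \<le> length lam" "p = part lam i" unfolding set_conv_part by auto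
    then show "int p \<in> beta (doubled lam)"
      using rows(1)[of i] unfolding beta_def by (intro CollectI exI[of _ i]) simp
  qed
  show "- int p \<in> beta (doubled lam) \<longleftrightarrow> p \<notin> set lam" if "0 < p"
  proof -
    have "- int p \<notin> beta (doubled lam) \<longleftrightarrow> p \<in> set lam"
      unfolding gap_iff[OF doubled_partition(1)[OF assms]]
    proof
      assume "\<exists>j\<ge>1. - int p = int j - int (part (conjugate (doubled lam)) j) - 1"
      then obtain j where j: "1 \<le> j" "- int p = int j - int (part (conjugate (doubled lam)) j) - 1"
        by blast
      then have "j \<le> length lam" using cols(2)[of j] \<open>0 < p\<close> by force
      then show "p \<in> set lam" unfolding set_conv_part using j cols(1)[of j] by force
    next
      assume "p \<in> set lam"
      then obtain j where "1 \<le> j" "j \<le> length lam" "p = part lam j" unfolding set_conv_part by auto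
      then show "\<exists>j\<ge>1. - int p = int j - int (part (conjugate (doubled lam)) j) - 1"
        using cols(1)[of j] by (intro exI[of _ j]) simp
    qed
    then show ?thesis by blast
  qed
qed

lemma shifted_boxes_doubled:
  assumes "lam \<in> distinct_partitions" "1 \<le> i" "i \<le> length lam"
  shows "(i, j) \<in> shifted_boxes lam \<longleftrightarrow> (i, j) \<in> boxes (doubled lam) \<and> i < j"
  using doubled_rows(1)[OF assms(1,2,3)] assms(2,3) by (auto simp: shifted_boxes_def boxes_def)

text \<open>The definition of the hook lengths in a shifted diagram is made for this to hold: the part
  with the index of the column supplies the missing piece of the leg.\<close>

lemma shifted_hook_doubled:
  assumes "lam \<in> distinct_partitions" "(i, j) \<in> shifted_boxes lam"
  shows "shifted_hook lam (i, j) = hook (doubled lam) (i, j)"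
proof -
  have ij: "1 \<le> i" "i \<le> length lam" "i < j" "1 \<le> j" using assms(2) by (auto simp: shifted_boxes_def)
  have arm: "{j'. j < j' \<and> (i, j') \<in> shifted_boxes lam} = {j'. j < j' \<and> (i, j') \<in> boxes (doubled lam)}"
    unfolding shifted_boxes_doubled[OF assms(1) ij(1,2)] using ij(3)
    by (intro Collect_cong) linarith
  define h where "h = card {i'. (i', j) \<in> shifted_boxes lam}"
  have col: "(i', j) \<in> shifted_boxes lam \<longleftrightarrow> 1 \<le> i' \<and> i' \<le> h" for i'
  proof -
    have "i' \<in> {i'. (i', j) \<in> shifted_boxes lam} \<longleftrightarrow> i' \<in> {1..h}"
      unfolding h_def using shifted_column[OF assms(1), of j] by (rule eqset_imp_iff)
    then show ?thesis by (simp only: mem_Collect_eq atLeastAtMost_iff)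
  qed
  have "{i'. i < i' \<and> (i', j) \<in> shifted_boxes lam} = {i<..h}" using ij(1) by (auto simp: col)
  moreover have "{i'. i < i' \<and> (i', j) \<in> boxes (doubled lam)} = {i<..h + part lam j}"
  proof -
    have "(i', j) \<in> boxes (doubled lam) \<longleftrightarrow> i' \<le> h + part lam j" if "1 \<le> i'" for i'
      unfolding h_def using doubled_partition(2)[OF assms(1) that ij(4)] .
    then show ?thesis using ij(1) by auto
  qed
  moreover have "i \<le> h" using col[of i] assms(2) by simp
  ultimately show ?thesis by (simp add: shifted_hook_def hook_def arm)
qed

lemma d_cores_iff:
  assumes "lam \<in> distinct_partitions"
  shows "lam \<in> d_cores N \<longleftrightarrow> (\<forall>b\<in>shifted_boxes lam. hook (doubled lam) b \<noteq> N)"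
proof -
  have "finite (shifted_boxes lam)"
    by (rule finite_subset[of _ "Sigma {..length lam} (\<lambda>i. {..i + part lam i})"])
      (auto simp: shifted_boxes_def)
  then have "N \<in># shifted_hooks lam \<longleftrightarrow> (\<exists>b\<in>shifted_boxes lam. shifted_hook lam b = N)"
    by (auto simp: shifted_hooks_def)
  also have "\<dots> \<longleftrightarrow> (\<exists>b\<in>shifted_boxes lam. hook (doubled lam) b = N)"
    using shifted_hook_doubled[OF assms] by force
  finally show ?thesis using assms by (auto simp: d_cores_def)
qed

text \<open>Boxes of the doubled diagram are pairs of a bead \<open>s\<close> and a gap \<open>t < s\<close>, with hook length \<open>s - t\<close>. A box
  outside of the shifted diagram has \<open>t < 0\<close>; by the symmetry of the word \<open>- t\<close> is a bead and \<open>- s\<close> a gap,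
  and this pair is a box with the same hook length, which lies in the shifted diagram unless \<open>t = - s\<close>. In the
  exceptional case \<open>s\<close> is a part and the hook length is \<open>2 * s\<close>. So the two conditions that define
  \<open>dr_cores\<close> exclude \<open>N\<close> from all hook lengths of the doubled diagram.\<close>

lemma dr_cores_iff:
  assumes "0 < N"
  shows "lam \<in> dr_cores N \<longleftrightarrow> lam \<in> distinct_partitions \<and> doubled lam \<in> cores N"
proof (cases "lam \<in> distinct_partitions")
  case lam: True
  let ?mu = "doubled lam"
  have mu: "is_partition ?mu" using doubled_partition(1)[OF lam] .
  have pos: "0 \<notin> set lam" using lam by (simp add: distinct_partitions_def)
  note rows = doubled_rows[OF lam] and cols = doubled_columns[OF lam]
  show ?thesis
  proof
    assume "lam \<in> dr_cores N"
    then have dr: "\<And>b. b \<in> shifted_boxes lam \<Longrightarrow> hook ?mu b \<noteq> N" "\<And>p. p \<in> set lam \<Longrightarrow> 2 * p \<noteq> N"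
      unfolding dr_cores_def using d_cores_iff[OF lam] by blast+
    have no_hook: False if ij: "1 \<le> i" "i \<le> length lam" "i < j"
      and N: "int (part lam i) - (int j - int (part (conjugate ?mu) j) - 1) = int N" for i j
    proof -
      have j: "1 \<le> j" using ij by simp
      have s: "int (part ?mu i) - int i = int (part lam i)" using rows(1)[OF ij(1,2)] by simp
      have box: "(i, j) \<in> boxes ?mu" using box_iff_beads[OF mu ij(1) j] s N assms by simp
      then have "int (hook ?mu (i, j)) = int N" using hook_beads[OF mu box] s N by simp
      then show False using dr(1)[of "(i, j)"] box shifted_boxes_doubled[OF lam ij(1,2)] ij(3) by simp
    qed
    have nonneg: "int p - int N \<in> beta ?mu" if p: "p \<in> set lam" for p
    proof (rule ccontr)
      assume "int p - int N \<notin> beta ?mu"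
      then obtain j where j: "1 \<le> j" "int p - int N = int j - int (part (conjugate ?mu) j) - 1"
        unfolding gap_iff[OF mu] by blast
      obtain i where i: "1 \<le> i" "i \<le> length lam" "p = part lam i"
        using p unfolding set_conv_part by blast
      consider "i < j" | "j = i" | "j < i" by linarith
      then show False
      proof cases
        case 1
        moreover have "int (part lam i) - (int j - int (part (conjugate ?mu) j) - 1) = int N"
          using j(2) i(3) by linarith
        ultimately show ?thesis by (rule no_hook[OF i(1,2)])
      next
        case 2
        then have "2 * p = N" using cols(1)[OF i(1,2)] j i(3) by simp
        then show ?thesis using dr(2)[OF p] by simp
      next
        case 3
        then have "j \<le> length lam" using i(2) by simp
        then have "int (part lam j) - (int i - int (part (conjugate ?mu) i) - 1) = int N"
          using j i(3) cols(1)[OF j(1)] cols(1)[OF i(1,2)] by linarith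
        then show ?thesis by (rule no_hook[OF j(1) \<open>j \<le> length lam\<close> 3])
      qed
    qed
    have "k - int N \<in> beta ?mu" if k: "k \<in> beta ?mu" for k
    proof (cases "0 \<le> k")
      case True
      then obtain p where p: "k = int p" using nonneg_int_cases by blast
      then show ?thesis using k nonneg[of p] beta_doubled(1)[OF lam] by simp
    next
      case False
      define p where "p = nat (- k)"
      have p: "k = - int p" "0 < p" using False by (auto simp: p_def)
      \<comment> \<open>Moving the bead \<open>- p\<close> to \<open>- p - N\<close> mirrors moving \<open>p + N\<close> to \<open>p\<close>.\<close>
      then have "p \<notin> set lam" using k beta_doubled(2)[OF lam p(2)] by simp
      then have "int (p + N) - int N \<notin> beta ?mu" using beta_doubled(1)[OF lam, of p] by simp
      then have "p + N \<notin> set lam" using nonneg[of "p + N"] by blast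
      then have "- int (p + N) \<in> beta ?mu" using beta_doubled(2)[OF lam, of "p + N"] p(2) by simp
      then show ?thesis by (simp add: p(1))
    qed
    then show "lam \<in> distinct_partitions \<and> ?mu \<in> cores N"
      unfolding cores_iff[OF assms] using lam mu by blast
  next
    assume "lam \<in> distinct_partitions \<and> ?mu \<in> cores N"
    then have core: "?mu \<in> cores N" by simp
    have "hook ?mu b \<noteq> N" if b: "b \<in> shifted_boxes lam" for b
    proof -
      obtain i j where ij: "b = (i, j)" by (cases b)
      then have "b \<in> boxes ?mu"
        using b shifted_boxes_doubled[OF lam, of i j] by (auto simp: shifted_boxes_def)
      then show ?thesis using core by (auto simp: cores_def)
    qed
    then have "lam \<in> d_cores N" unfolding d_cores_iff[OF lam] by blast
    moreover have "2 * p \<noteq> N" if p: "p \<in> set lam" for p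
    proof
      assume "2 * p = N"
      then have "int p - int N = - int p" by simp
      moreover have "int p \<in> beta ?mu" using p beta_doubled(1)[OF lam] by simp
      then have "int p - int N \<in> beta ?mu" using core unfolding cores_iff[OF assms] by blast
      moreover have "0 < p" using p pos by (metis gr0I)
      ultimately show False using p beta_doubled(2)[OF lam, of p] by metis
    qed
    ultimately show "lam \<in> dr_cores N" unfolding dr_cores_def by blast
  qed
qed (auto simp: dr_cores_def d_cores_def)

section \<open>Reading the abacus\<close>

lemma phi_nth:
  assumes "i < N" "\<And>k. k * int N + int i \<in> beta c \<longleftrightarrow> k < v"
  shows "phi N c ! i = v"
proof -
  have "(LEAST k::int. word c (k * int N + int i) = 1) = v"
    unfolding word_eq_1_beta assms(2) by (rule Least_equality) auto
  then show ?thesis using assms(1) by (simp add: phi_def)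
qed

lemma length_phi: "length (phi N c) = N"
  by (simp add: phi_def)

text \<open>On a runner of the abacus of a core the beads are pushed to the left without gaps, so \<open>phi\<close> contains all
  information about the word.\<close>

lemma runner_of_core:
  assumes "c \<in> cores N" "i < N"
  shows "k * int N + int i \<in> beta c \<longleftrightarrow> k < phi N c ! i"
proof -
  have N: "0 < N" using assms(2) by simp
  have c: "is_partition c" using assms(1) by (rule core_partition)
  define P where "P k \<longleftrightarrow> k * int N + int i \<notin> beta c" for k
  \<comment> \<open>All positions to the left of \<open>a\<close> are beads, so that least elements exist.\<close>
  define a where "a = - int (length c) - 1"
  have low: "\<not> P k" if "k < a" for k
  proof -
    have "k * int N + int i < (k + 1) * int N" using assms(2) by (simp add: algebra_simps)
    also have "\<dots> \<le> (k + 1) * 1" using that N by (intro mult_left_mono_neg) (auto simp: a_def)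
    also have "\<dots> < - int (length c)" using that by (simp add: a_def)
    finally show ?thesis using beta_bounds(2)[OF c] by (simp add: P_def)
  qed
  have "P (a + int (part c 1 + length c + 1))"
  proof -
    have "int (part c 1) \<le> int (part c 1) * int N + int i" using N
      by (cases N) (auto simp: algebra_simps)
    then show ?thesis using beta_bounds(1)[OF c] by (force simp: P_def a_def)
  qed
  then have "P (a + int (LEAST m. P (a + int m)))" by (rule LeastI)
  moreover define v where "v = a + int (LEAST m. P (a + int m))"
  ultimately have Pv: "P v" by (simp only:)
  have beta_v: "k * int N + int i \<in> beta c \<longleftrightarrow> k < v" for k
  proof (cases "k < v")
    case True
    have "\<not> P k"
    proof (cases "k < a")
      case False
      then have "nat (k - a) < (LEAST m. P (a + int m))" using True by (simp add: v_def)
      then have "\<not> P (a + int (nat (k - a)))" by (rule not_less_Least)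
      then show ?thesis using False by simp
    qed (rule low)
    then show ?thesis using True by (simp add: P_def)
  next
    case False
    have "k * int N + int i \<notin> beta c"
    proof
      assume "k * int N + int i \<in> beta c"
      then have "k * int N + int i - int (nat (k - v)) * int N \<in> beta c"
        by (rule core_beta_shift[OF assms(1) N])
      moreover have "k * int N + int i - int (nat (k - v)) * int N = v * int N + int i"
        using False by (simp add: algebra_simps)
      ultimately show False using Pv unfolding P_def by (simp only:)
    qed
    then show ?thesis using False by simp
  qed
  then show ?thesis using phi_nth[OF assms(2) beta_v] by simp
qed

lemma inj_on_phi:
  assumes "0 < N"
  shows "inj_on (phi N) (cores N)"
proof (rule inj_onI)
  fix c d assume c: "c \<in> cores N" and d: "d \<in> cores N" and eq: "phi N c = phi N d"
  have "x \<in> beta c \<longleftrightarrow> x \<in> beta d" for x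
  proof -
    define i where "i = nat (x mod int N)"
    have i: "i < N" "x = x div int N * int N + int i"
      using assms by (simp_all add: i_def nat_less_iff)
    show ?thesis
      using runner_of_core[OF c i(1), of "x div int N"] runner_of_core[OF d i(1), of "x div int N"]
        i(2) eq by simp
  qed
  then show "c = d" using c d core_partition by (intro beta_inj) auto
qed

section \<open>Inserting two runners\<close>

text \<open>The position \<open>s\<close> of the abacus with \<open>2 * n\<close> runners is moved to this position of the abacus
  with \<open>2 * n + 2\<close> runners, whose new runners 0 and \<open>n + 1\<close> consist of the multiples of \<open>n + 1\<close>.\<close>

definition stretch_pos :: "nat \<Rightarrow> int \<Rightarrow> int" where
  "stretch_pos n s = s + 1 + s div int n"

lemma stretch_pos_of_nat: "stretch_pos n (int s) = int (stretch n s)"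
  by (simp add: stretch_pos_def stretch_def zdiv_int)

lemma stretch_pos_runner:
  assumes "0 \<le> r" "r < int n"
  shows "stretch_pos n (q * int n + r) = q * (int n + 1) + r + 1"
proof -
  have "(q * int n + r) div int n = q" using assms by simp
  then show ?thesis by (simp add: stretch_pos_def algebra_simps)
qed

lemma stretch_pos_mirror:
  assumes "0 < n"
  shows "stretch_pos n (- 1 - s) = - stretch_pos n s"
proof -
  define q r where "q = s div int n" and "r = s mod int n"
  have s: "s = q * int n + r" "0 \<le> r" "r < int n" using assms by (auto simp: q_def r_def)
  have e: "- 1 - s = (- q - 1) * int n + (int n - 1 - r)" by (simp add: s(1) algebra_simps)
  have "stretch_pos n (- 1 - s) = (- q - 1) * (int n + 1) + (int n - 1 - r) + 1"
    unfolding e by (rule stretch_pos_runner) (use s(2,3) in simp_all)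
  then show ?thesis using stretch_pos_runner[OF s(2,3), of q] s(1) by (simp add: algebra_simps)
qed

lemma stretch_pos_shift:
  assumes "0 < n"
  shows "stretch_pos n (s - int (2 * n)) = stretch_pos n s - int (2 * n + 2)"
proof -
  have "s - int (2 * n) = s + (- 2) * int n" by simp
  then have "(s - int (2 * n)) div int n = s div int n - 2"
    using assms by (simp only: div_mult_self1)
  then show ?thesis by (simp add: stretch_pos_def)
qed

lemma position_cases:
  assumes "0 < n"
  obtains q where "x = q * (int n + 1)" | s where "x = stretch_pos n s"
proof (cases "x mod (int n + 1) = 0")
  case True
  then have "x = x div (int n + 1) * (int n + 1)" by (simp add: mod_0_imp_dvd)
  then show ?thesis by (rule that(1))
next
  case False
  define q r where "q = x div (int n + 1)" and "r = x mod (int n + 1)"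
  have "0 \<le> r" "r < int n + 1" using pos_mod_sign[of "int n + 1" x] pos_mod_bound[of "int n + 1" x]
    by (simp_all add: r_def)
  moreover have "r \<noteq> 0" using False by (simp add: r_def)
  ultimately have r: "0 \<le> r - 1" "r - 1 < int n" by linarith+
  have "x = q * (int n + 1) + (r - 1) + 1"
    using div_mult_mod_eq[of x "int n + 1"] unfolding q_def r_def by linarith
  also have "\<dots> = stretch_pos n (q * int n + (r - 1))" by (rule stretch_pos_runner[OF r, symmetric])
  finally show ?thesis by (rule that(2))
qed

lemma stretch_pos_not_multiple:
  assumes "0 < n"
  shows "stretch_pos n s \<noteq> q * (int n + 1)"
proof
  define p r where "p = s div int n" and "r = s mod int n"
  have s: "s = p * int n + r" "0 \<le> r" "r < int n" using assms by (auto simp: p_def r_def)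
  assume "stretch_pos n s = q * (int n + 1)"
  then have "p * (int n + 1) + r + 1 = q * (int n + 1)" using stretch_pos_runner[OF s(2,3), of p] s(1) by simp
  then have "r + 1 = (q - p) * (int n + 1)" by (simp add: algebra_simps)
  then have "(int n + 1) dvd r + 1" by simp
  then show False using s(2,3) zdvd_imp_le[of "int n + 1" "r + 1"] by simp
qed

lemma inj_stretch: "inj (stretch n)"
proof (rule linorder_inj_onI')
  fix i j :: nat assume "i < j"
  then show "stretch n i \<noteq> stretch n j" using div_le_mono[of i j n] by (simp add: stretch_def)
qed

text \<open>The parts are the positions to which the insertion of the two runners moves the nonnegative beads.\<close>

definition stretched :: "nat \<Rightarrow> nat list \<Rightarrow> nat list" where
  "stretched n c = rev (sorted_list_of_set (stretch n ` pos_beads c))"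

lemma set_stretched: "is_partition c \<Longrightarrow> set (stretched n c) = stretch n ` pos_beads c"
  by (simp add: stretched_def finite_pos_beads)

lemma stretched_distinct:
  assumes "is_partition c"
  shows "stretched n c \<in> distinct_partitions"
proof -
  have "0 \<notin> set (stretched n c)" by (auto simp: set_stretched[OF assms] stretch_def)
  moreover have "sorted_wrt (>) (stretched n c)"
    unfolding stretched_def sorted_wrt_rev by (rule strict_sorted_list_of_set)
  ultimately show ?thesis by (simp add: distinct_partitions_def)
qed

lemma sum_list_stretched:
  assumes "is_partition c"
  shows "sum_list (stretched n c) = (\<Sum>s\<in>pos_beads c. stretch n s)"
proof -
  have "distinct (stretched n c)" by (simp add: stretched_def)
  then have "sum_list (stretched n c) = \<Sum>(set (stretched n c))"
    using sum_list_distinct_conv_sum_set[of "stretched n c" "\<lambda>x. x"] by simp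
  also have "\<dots> = (\<Sum>s\<in>pos_beads c. stretch n s)"
    unfolding set_stretched[OF assms]
    by (rule sum.reindex_cong[OF inj_on_subset[OF inj_stretch]]) auto
  finally show ?thesis .
qed

text \<open>The last hypothesis is the claim for nonnegative positions. The negative ones follow, because
  \<open>stretch_pos\<close> turns the symmetry of the word of a self-conjugate partition, which exchanges \<open>k\<close> and
  \<open>- 1 - k\<close>, into the symmetry about 0 of the doubled word.\<close>

lemma beta_doubled_stretch_pos:
  assumes "lam \<in> distinct_partitions" "0 < n"
    and "\<And>k. k \<in> beta c \<longleftrightarrow> - 1 - k \<notin> beta c"
    and "\<And>s. stretch n s \<in> set lam \<longleftrightarrow> s \<in> pos_beads c"
  shows "stretch_pos n s \<in> beta (doubled lam) \<longleftrightarrow> s \<in> beta c"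
proof (cases "0 \<le> s")
  case True
  then obtain m where "s = int m" using nonneg_int_cases by blast
  then show ?thesis
    using beta_doubled(1)[OF assms(1), of "stretch n m"] assms(4)[of m]
    by (simp add: stretch_pos_of_nat pos_beads_def)
next
  case False
  define m where "m = nat (- 1 - s)"
  have m: "- 1 - s = int m" "s = - 1 - int m" using False by (auto simp: m_def)
  have "stretch_pos n s = - int (stretch n m)"
    unfolding m(2) stretch_pos_mirror[OF assms(2)] stretch_pos_of_nat ..
  moreover have "0 < stretch n m" by (simp add: stretch_def)
  ultimately have "stretch_pos n s \<in> beta (doubled lam) \<longleftrightarrow> m \<notin> pos_beads c"
    using beta_doubled(2)[OF assms(1)] assms(4) by simp
  then show ?thesis using assms(3)[of s] m(1) by (simp add: pos_beads_def)
qed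

lemma beta_doubled_multiple:
  assumes "lam \<in> distinct_partitions" "\<And>q. q * (n + 1) \<notin> set lam"
  shows "q * (int n + 1) \<in> beta (doubled lam) \<longleftrightarrow> q < 0"
proof (cases "q < 0")
  case True
  have "q * (int n + 1) = - int (nat (- q) * (n + 1))" using True by (simp add: algebra_simps)
  moreover have "0 < nat (- q) * (n + 1)" using True by simp
  ultimately have "q * (int n + 1) \<in> beta (doubled lam)"
    using beta_doubled(2)[OF assms(1)] assms(2) by metis
  then show ?thesis using True by simp
next
  case False
  then have "q * (int n + 1) = int (nat q * (n + 1))" by (simp add: algebra_simps)
  then have "q * (int n + 1) \<notin> beta (doubled lam)"
    using beta_doubled(1)[OF assms(1)] assms(2) by metis
  then show ?thesis using False by simp
qed

lemma stretch_not_multiple: "0 < n \<Longrightarrow> stretch n s \<noteq> q * (n + 1)"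
  using stretch_pos_not_multiple[of n "int s" "int q"] unfolding stretch_pos_of_nat
  by (metis of_nat_1 of_nat_add of_nat_mult)

lemma beta_doubled_stretched:
  assumes "c \<in> sc_cores (2 * n)" "0 < n"
  shows "stretch_pos n s \<in> beta (doubled (stretched n c)) \<longleftrightarrow> s \<in> beta c"
    and "q * (int n + 1) \<in> beta (doubled (stretched n c)) \<longleftrightarrow> q < 0"
proof -
  have c: "is_partition c" "\<And>k. k \<in> beta c \<longleftrightarrow> - 1 - k \<notin> beta c"
    using assms(1) core_partition unfolding sc_cores_iff by blast+
  have "stretch n s \<in> set (stretched n c) \<longleftrightarrow> s \<in> pos_beads c" for s
    unfolding set_stretched[OF c(1)] using inj_stretch[of n] by (simp add: inj_image_mem_iff)
  then show "stretch_pos n s \<in> beta (doubled (stretched n c)) \<longleftrightarrow> s \<in> beta c"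
    using beta_doubled_stretch_pos[OF stretched_distinct[OF c(1)] assms(2) c(2)] by blast
  have "q * (n + 1) \<notin> set (stretched n c)" for q
    unfolding set_stretched[OF c(1)] using stretch_not_multiple[OF assms(2)] by (metis imageE)
  then show "q * (int n + 1) \<in> beta (doubled (stretched n c)) \<longleftrightarrow> q < 0"
    by (rule beta_doubled_multiple[OF stretched_distinct[OF c(1)]])
qed

lemma doubled_stretched_core:
  assumes "c \<in> sc_cores (2 * n)" "0 < n"
  shows "doubled (stretched n c) \<in> cores (2 * n + 2)"
proof -
  have c: "c \<in> cores (2 * n)" using assms(1) by (simp add: sc_cores_iff)
  have "x - int (2 * n + 2) \<in> beta (doubled (stretched n c))"
    if x: "x \<in> beta (doubled (stretched n c))" for x
  proof (cases x rule: position_cases[OF assms(2)])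
    case (1 q)
    then have "q < 0" using x beta_doubled_stretched(2)[OF assms] by blast
    moreover have "x - int (2 * n + 2) = (q - 2) * (int n + 1)" by (simp add: 1 algebra_simps)
    ultimately show ?thesis using beta_doubled_stretched(2)[OF assms, of "q - 2"] by simp
  next
    case (2 s)
    then have "s \<in> beta c" using x beta_doubled_stretched(1)[OF assms] by blast
    then have "s - int (2 * n) \<in> beta c" using c cores_iff[of "2 * n" c] assms(2) by simp
    then show ?thesis
      using beta_doubled_stretched(1)[OF assms] unfolding 2 stretch_pos_shift[OF assms(2), symmetric]
      by blast
  qed
  moreover have "is_partition (doubled (stretched n c))"
    using doubled_partition(1)[OF stretched_distinct[OF core_partition[OF c]]] .
  moreover have N: "0 < 2 * n + 2" by simp
  ultimately show ?thesis unfolding cores_iff[OF N] by blast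
qed

lemma stretched_dr_core:
  assumes "c \<in> sc_cores (2 * n)" "0 < n"
  shows "stretched n c \<in> dr_cores (2 * n + 2)"
proof -
  have "is_partition c" using assms(1) core_partition unfolding sc_cores_iff by blast
  then show ?thesis
    using dr_cores_iff[of "2 * n + 2"] stretched_distinct doubled_stretched_core[OF assms] by simp
qed

text \<open>The runners 0 and \<open>n + 1\<close> consist of multiples of \<open>n + 1\<close> and change from beads to gaps at 0. The
  others are the runners of \<open>c\<close> in the same order, the second half of which is the mirror image of
  the first.\<close>

lemma phi_doubled_stretched:
  assumes "c \<in> sc_cores (2 * n)" "0 < n"
  defines "m \<equiv> take n (phi (2 * n) c)"
  shows "phi (2 * n + 2) (doubled (stretched n c)) = [0] @ m @ [0] @ rev (map uminus m)"
proof (rule nth_equalityI)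
  have c: "c \<in> cores (2 * n)" "\<And>k. k \<in> beta c \<longleftrightarrow> - 1 - k \<notin> beta c"
    using assms(1) unfolding sc_cores_iff by blast+
  let ?T = "beta (doubled (stretched n c))"
  have len: "length m = n" by (simp add: m_def length_phi)
  have m: "m ! i = phi (2 * n) c ! i" if "i < n" for i using that by (simp add: m_def)
  show "length (phi (2 * n + 2) (doubled (stretched n c))) = length ([0] @ m @ [0] @ rev (map uminus m))"
    by (simp add: length_phi len)
  fix i assume "i < length (phi (2 * n + 2) (doubled (stretched n c)))"
  then have i: "i < 2 * n + 2" by (simp add: length_phi)
  show "phi (2 * n + 2) (doubled (stretched n c)) ! i = ([0] @ m @ [0] @ rev (map uminus m)) ! i"
  proof (rule phi_nth[OF i])
    fix k :: int
    consider "i = 0" | j where "i = Suc j" "j < n" | "i = n + 1"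
      | j where "i = n + 2 + j" "j < n"
    proof -
      assume a: "i = 0 \<Longrightarrow> thesis" "\<And>j. i = Suc j \<Longrightarrow> j < n \<Longrightarrow> thesis"
        "i = n + 1 \<Longrightarrow> thesis" "\<And>j. i = n + 2 + j \<Longrightarrow> j < n \<Longrightarrow> thesis"
      show thesis using a(1) a(2)[of "i - 1"] a(3) a(4)[of "i - (n + 2)"] i by linarith
    qed
    then show "k * int (2 * n + 2) + int i \<in> ?T
      \<longleftrightarrow> k < ([0] @ m @ [0] @ rev (map uminus m)) ! i"
    proof cases
      case 1
      have e: "k * int (2 * n + 2) + int i = (2 * k) * (int n + 1)" by (simp add: 1 algebra_simps)
      show ?thesis unfolding e beta_doubled_stretched(2)[OF assms(1,2)] using 1 by simp
    next
      case (2 j)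
      have "k * int (2 * n + 2) + int i = stretch_pos n ((2 * k) * int n + int j)"
        using stretch_pos_runner[of "int j" n "2 * k"] 2 by (simp add: algebra_simps)
      moreover have "(2 * k) * int n + int j = k * int (2 * n) + int j" by simp
      ultimately have "k * int (2 * n + 2) + int i \<in> ?T \<longleftrightarrow> k * int (2 * n) + int j \<in> beta c"
        using beta_doubled_stretched(1)[OF assms(1,2)] by metis
      also have "\<dots> \<longleftrightarrow> k < m ! j" using runner_of_core[OF c(1), of j k] 2 m by simp
      finally show ?thesis using 2 len by (simp add: nth_append)
    next
      case 3
      have e: "k * int (2 * n + 2) + int i = (2 * k + 1) * (int n + 1)"
        by (simp add: 3 algebra_simps)
      show ?thesis unfolding e beta_doubled_stretched(2)[OF assms(1,2)]
        using 3 len by (simp add: nth_append) linarith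
    next
      case (4 j)
      have "k * int (2 * n + 2) + int i = stretch_pos n ((2 * k + 1) * int n + int j)"
        using stretch_pos_runner[of "int j" n "2 * k + 1"] 4 by (simp add: algebra_simps)
      then have "k * int (2 * n + 2) + int i \<in> ?T \<longleftrightarrow> (2 * k + 1) * int n + int j \<in> beta c"
        using beta_doubled_stretched(1)[OF assms(1,2)] by metis
      also have "\<dots> \<longleftrightarrow> - 1 - ((2 * k + 1) * int n + int j) \<notin> beta c" by (rule c(2))
      also have "- 1 - ((2 * k + 1) * int n + int j) = (- k - 1) * int (2 * n) + int (n - 1 - j)"
        using 4 by (simp add: algebra_simps of_nat_diff)
      also have "\<dots> \<notin> beta c \<longleftrightarrow> k < - (m ! (n - 1 - j))"
        using runner_of_core[OF c(1), of "n - 1 - j" "- k - 1"] 4 m[of "n - 1 - j"] by auto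
      finally show ?thesis using 4 len by (simp add: nth_append rev_nth)
    qed
  qed
qed

lemma lift_core_eq:
  assumes "c \<in> sc_cores (2 * n)" "0 < n"
  shows "lift_core n c = doubled (stretched n c)"
  unfolding lift_core_def Let_def phi_doubled_stretched[OF assms, symmetric] phi_inv_def
  by (rule inv_into_f_f[OF inj_on_phi doubled_stretched_core[OF assms]]) simp

section \<open>The bijection\<close>

lemma doubled_inj:
  assumes "lam \<in> distinct_partitions" "mu \<in> distinct_partitions" "doubled lam = doubled mu"
  shows "lam = mu"
proof -
  have set: "set lam = set mu" using beta_doubled(1) assms by (metis set_eqI)
  have "rev lam = sorted_list_of_set (set lam)" if "lam \<in> distinct_partitions" for lam
  proof -
    have "sorted_wrt (<) (rev lam)" using that by (simp add: distinct_partitions_def sorted_wrt_rev)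
    then have "sorted_list_of_set (set (rev lam)) = rev lam"
      by (intro sorted_list_of_set.idem_if_sorted_distinct) (simp_all only: strict_sorted_iff)
    then show ?thesis by simp
  qed
  then show ?thesis using assms(1,2) set by (metis rev_rev_ident)
qed

lemma dr_core_distinct: "lam \<in> dr_cores N \<Longrightarrow> lam \<in> distinct_partitions"
  by (simp add: dr_cores_def d_cores_def)

lemma distinct_of_core_eq:
  assumes "c \<in> sc_cores (2 * n)" "0 < n"
  shows "distinct_of_core n c = stretched n c"
  unfolding distinct_of_core_def lift_core_eq[OF assms]
proof (rule the_equality)
  show "stretched n c \<in> dr_cores (2 * n + 2) \<and> doubled (stretched n c) = doubled (stretched n c)"
    using stretched_dr_core[OF assms] by simp
  then show "lam = stretched n c"
    if "lam \<in> dr_cores (2 * n + 2) \<and> doubled (stretched n c) = doubled lam" for lam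
    using that doubled_inj dr_core_distinct by metis
qed

text \<open>In a self-conjugate diagram, box \<open>(i, j)\<close> is number \<open>min i j\<close> on its diagonal, whose length is the number
  of beads that are at least \<open>\<bar>j - i\<bar>\<close>. Given any finite set as beads, this describes a
  diagram.\<close>

lemma exists_self_conjugate:
  assumes "finite P"
  obtains c where "is_partition c" "conjugate c = c" "pos_beads c = P"
proof -
  define G where "G d = card {s \<in> P. d \<le> s}" for d :: nat
  have G_Suc: "G d = G (Suc d) + of_bool (d \<in> P)" for d
  proof -
    have "{s \<in> P. d \<le> s} = (if d \<in> P then insert d {s \<in> P. Suc d \<le> s} else {s \<in> P. Suc d \<le> s})"
      by (auto simp: Suc_le_eq le_less)
    then show ?thesis using assms by (simp add: G_def)
  qed
  have G_le_Suc: "G d \<le> Suc (G (Suc d))" and G_Suc_le: "G (Suc d) \<le> G d" for d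
    unfolding G_Suc[of d] by simp_all
  define D where "D = {(i, j). 1 \<le> i \<and> 1 \<le> j \<and> (if i \<le> j then i \<le> G (j - i) else j \<le> G (i - j))}"
  have D_sym: "(i, j) \<in> D \<longleftrightarrow> (j, i) \<in> D" for i j by (auto simp: D_def)
  obtain M where M: "\<And>s. s \<in> P \<Longrightarrow> s \<le> M" using finite_nat_set_iff_bounded_le assms by auto
  have G_le: "G d \<le> card P" for d unfolding G_def by (rule card_mono) (use assms in auto)
  have G_0: "G d = 0" if "M < d" for d
  proof -
    have "{s \<in> P. d \<le> s} = {}" using M that by fastforce
    then show ?thesis unfolding G_def by (simp only: card.empty)
  qed
  have up: "(i, j) \<in> D" if "(Suc i, j) \<in> D" "1 \<le> i" for i j
  proof (cases "Suc i \<le> j")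
    case True
    then have "Suc (j - Suc i) = j - i" by simp
    then show ?thesis using that True G_le_Suc[of "j - Suc i"] by (auto simp: D_def split: if_splits)
  next
    case False
    show ?thesis
    proof (cases "i = j")
      case True
      then show ?thesis using that G_Suc_le[of 0] by (auto simp: D_def)
    next
      case neq: False
      then have "Suc i - j = Suc (i - j)" "j < i" using False by auto
      then show ?thesis using that G_Suc_le[of "i - j"] by (auto simp: D_def)
    qed
  qed
  have "is_diagram D" unfolding is_diagram_iff
  proof (intro conjI allI impI)
    have "i \<le> card P + M \<and> j \<le> card P + M" if "(i, j) \<in> D" for i j
      using that G_le[of "j - i"] G_le[of "i - j"] G_0[of "j - i"] G_0[of "i - j"]
      by (cases "M < j - i"; cases "M < i - j") (auto simp: D_def split: if_splits)
    then have "D \<subseteq> {..card P + M} \<times> {..card P + M}" by auto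
    then show "finite D" by (rule finite_subset) simp
    fix i j
    show "1 \<le> i" "1 \<le> j" if "(i, j) \<in> D" using that by (auto simp: D_def)
    show "(i, j) \<in> D" if "(Suc i, j) \<in> D" "1 \<le> i" using up that .
    show "(i, j) \<in> D" if "(i, Suc j) \<in> D" "1 \<le> j" using up[of j i] that D_sym by blast
  qed
  then obtain c where c: "is_partition c" "boxes c = D" unfolding is_diagram_def by blast
  have "boxes (conjugate c) = boxes c"
  proof (intro set_eqI, clarify)
    fix i j
    show "(i, j) \<in> boxes (conjugate c) \<longleftrightarrow> (i, j) \<in> boxes c"
      using le_part_iff[OF c(1), of j i] D_sym[of i j] unfolding c(2)[symmetric] by (auto simp: boxes_def)
  qed
  then have conj: "conjugate c = c" using boxes_inj is_partition_conjugate c(1) by blast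
  have diag: "diag c (int k) = G k" for k
  proof -
    have "{b \<in> boxes c. content b = int k} = (\<lambda>i. (i, i + k)) ` {1..G k}"
    proof -
      have "int b - int a = int k \<longleftrightarrow> b = a + k" for a b by auto
      then show ?thesis unfolding c(2) by (auto simp: D_def)
    qed
    then show ?thesis unfolding diag_def by (simp add: card_image inj_on_def)
  qed
  have "k \<in> pos_beads c \<longleftrightarrow> k \<in> P" for k
  proof -
    have e: "int k + 1 = int (Suc k)" by simp
    have "(of_bool (int k \<in> beta c) :: int) = of_bool (k \<in> P)"
      using diag_step[OF c(1), of "int k", unfolded e diag] G_Suc[of k] by simp
    then show ?thesis unfolding pos_beads_def of_bool_eq_iff by simp
  qed
  then show ?thesis using that[OF c(1) conj] by blast
qed

text \<open>Such a part could be moved along its runner to the position 0, which is a gap, or otherwise both to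
  \<open>n + 1\<close> and to \<open>- (n + 1)\<close>, only one of which is a bead.\<close>

lemma dr_core_no_multiple:
  assumes "lam \<in> dr_cores (2 * n + 2)"
  shows "q * (n + 1) \<notin> set lam"
proof
  assume q: "q * (n + 1) \<in> set lam"
  have lam: "lam \<in> distinct_partitions" using assms by (rule dr_core_distinct)
  have N: "0 < 2 * n + 2" by simp
  have core: "doubled lam \<in> cores (2 * n + 2)" using assms dr_cores_iff[OF N] by blast
  have "0 \<notin> set lam" using lam by (simp add: distinct_partitions_def)
  then have zero: "int 0 \<notin> beta (doubled lam)" using beta_doubled(1)[OF lam, of 0] by simp
  have sub: "int (q * (n + 1)) - int k * int (2 * n + 2) \<in> beta (doubled lam)" for k
    using core_beta_shift[OF core N] beta_doubled(1)[OF lam] q by blast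
  show False
  proof (cases "even q")
    case True
    then obtain k where "q = 2 * k" by (rule evenE)
    then have "int (q * (n + 1)) - int k * int (2 * n + 2) = int 0" by (simp add: algebra_simps)
    then show False using sub[of k] zero by simp
  next
    case False
    then obtain k where k: "q = 2 * k + 1" by (rule oddE)
    then have "int (q * (n + 1)) - int k * int (2 * n + 2) = int (n + 1)"
      "int (q * (n + 1)) - int (Suc k) * int (2 * n + 2) = - int (n + 1)"
      by (simp_all add: algebra_simps)
    then have "int (n + 1) \<in> beta (doubled lam)" "- int (n + 1) \<in> beta (doubled lam)"
      using sub[of k] sub[of "Suc k"] by (simp_all only:)
    then show False using beta_doubled[OF lam, of "n + 1"] by simp
  qed
qed

text \<open>As no part is a multiple of \<open>n + 1\<close>, the parts come from a set of nonnegative beads. The self-conjugate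
  partition with these beads is a core because \<open>stretch_pos\<close> takes steps of \<open>2 * n\<close> to steps of
  \<open>2 * n + 2\<close>.\<close>

lemma stretched_surj:
  assumes "lam \<in> dr_cores (2 * n + 2)" "0 < n"
  obtains c where "c \<in> sc_cores (2 * n)" "stretched n c = lam"
proof -
  have lam: "lam \<in> distinct_partitions" using assms(1) by (rule dr_core_distinct)
  have N: "0 < 2 * n + 2" "0 < 2 * n" using assms(2) by simp_all
  have core: "doubled lam \<in> cores (2 * n + 2)" using assms(1) dr_cores_iff[OF N(1)] by blast
  have "finite {s. stretch n s \<in> set lam}"
    using finite_vimageI[OF finite_set inj_stretch[of n], of lam] by (simp add: vimage_def)
  then obtain c where c: "is_partition c" "conjugate c = c" "pos_beads c = {s. stretch n s \<in> set lam}"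
    by (rule exists_self_conjugate)
  have sym: "\<And>k. k \<in> beta c \<longleftrightarrow> - 1 - k \<notin> beta c" using conjugate_eq_iff[OF c(1)] c(2) by blast
  have T: "stretch_pos n s \<in> beta (doubled lam) \<longleftrightarrow> s \<in> beta c" for s
    by (rule beta_doubled_stretch_pos[OF lam assms(2) sym]) (simp add: c(3))
  have "k - int (2 * n) \<in> beta c" if "k \<in> beta c" for k
  proof -
    have "stretch_pos n k - int (2 * n + 2) \<in> beta (doubled lam)"
      using that core unfolding T[symmetric] cores_iff[OF N(1)] by blast
    then show ?thesis unfolding stretch_pos_shift[OF assms(2), symmetric] T .
  qed
  then have sc: "c \<in> sc_cores (2 * n)"
    unfolding sc_cores_iff cores_iff[OF N(2)] using c(1) sym by blast
  have "set (stretched n c) = set lam"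
  proof -
    have "p \<in> range (stretch n)" if p: "p \<in> set lam" for p
    proof (cases "int p" rule: position_cases[OF assms(2)])
      case (1 q)
      then have "0 \<le> q * (int n + 1)" by simp
      then have "0 \<le> q" by (simp add: zero_le_mult_iff)
      then have "int p = int (nat q * (n + 1))" using 1 by (simp add: algebra_simps)
      then have "p = nat q * (n + 1)" by (simp only: of_nat_eq_iff)
      then show ?thesis using p dr_core_no_multiple[OF assms(1)] by blast
    next
      case (2 s)
      have "0 \<le> s"
      proof (rule ccontr)
        assume "\<not> 0 \<le> s"
        then have "s div int n < 0" using assms(2) by (simp add: pos_imp_zdiv_neg_iff)
        then have "stretch_pos n s \<le> 0" using \<open>\<not> 0 \<le> s\<close> by (simp add: stretch_pos_def)
        then have "p = 0" using 2 by simp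
        then show False using p lam by (auto simp: distinct_partitions_def)
      qed
      then have "int p = int (stretch n (nat s))" using 2 stretch_pos_of_nat[of n "nat s"] by simp
      then show ?thesis by simp
    qed
    then show ?thesis unfolding set_stretched[OF c(1)] c(3) by auto
  qed
  moreover have "beta (doubled mu) = beta (doubled nu)"
    if "mu \<in> distinct_partitions" "nu \<in> distinct_partitions" "set mu = set nu" for mu nu
  proof (intro set_eqI)
    fix k
    show "k \<in> beta (doubled mu) \<longleftrightarrow> k \<in> beta (doubled nu)"
    proof (cases "0 \<le> k")
      case True
      then obtain p where "k = int p" using nonneg_int_cases by blast
      then show ?thesis using beta_doubled(1) that by blast
    next
      case False
      then have "k = - int (nat (- k))" "0 < nat (- k)" by auto
      then show ?thesis using beta_doubled(2) that by metis
    qed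
  qed
  ultimately have "beta (doubled (stretched n c)) = beta (doubled lam)"
    using stretched_distinct[OF c(1)] lam by blast
  then have "doubled (stretched n c) = doubled lam"
    by (rule beta_inj[OF doubled_partition(1)[OF stretched_distinct[OF c(1)]] doubled_partition(1)[OF lam]])
  then have "stretched n c = lam" by (rule doubled_inj[OF stretched_distinct[OF c(1)] lam])
  then show ?thesis using that sc by blast
qed

lemma stretched_inj:
  assumes "c \<in> sc_cores (2 * n)" "d \<in> sc_cores (2 * n)" "0 < n" "stretched n c = stretched n d"
  shows "c = d"
proof (rule beta_inj)
  show "beta c = beta d"
    using beta_doubled_stretched(1)[OF assms(1,3)] beta_doubled_stretched(1)[OF assms(2,3)] assms(4)
    by auto
qed (use assms(1,2) core_partition in \<open>auto simp: sc_cores_iff\<close>)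

theorem proposition6p17:
  fixes n :: nat
  assumes "n \<ge> 2"
  shows "(\<forall>c\<in>sc_cores (2 * n).
            lift_core n c \<in> dd_cores (2 * n + 2)
            \<and> (\<exists>lam\<in>dr_cores (2 * n + 2). lift_core n c = doubled lam))
       \<and> bij_betw (distinct_of_core n) (sc_cores (2 * n)) (dr_cores (2 * n + 2))
       \<and> (\<forall>c\<in>sc_cores (2 * n). L_D n c = int (sum_list (distinct_of_core n c)))"
proof (intro conjI ballI)
  have n: "0 < n" using assms by simp
  show "bij_betw (distinct_of_core n) (sc_cores (2 * n)) (dr_cores (2 * n + 2))"
  proof (rule bij_betw_imageI)
    show "inj_on (distinct_of_core n) (sc_cores (2 * n))"
      using stretched_inj[OF _ _ n] by (intro inj_onI) (simp add: distinct_of_core_eq[OF _ n])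
    have "distinct_of_core n ` sc_cores (2 * n) = stretched n ` sc_cores (2 * n)"
      by (rule image_cong) (simp_all add: distinct_of_core_eq[OF _ n])
    also have "\<dots> = dr_cores (2 * n + 2)"
    proof (intro subset_antisym subsetI)
      fix lam assume "lam \<in> dr_cores (2 * n + 2)"
      then show "lam \<in> stretched n ` sc_cores (2 * n)" using stretched_surj[OF _ n] by (metis imageI)
    qed (use stretched_dr_core[OF _ n] in auto)
    finally show "distinct_of_core n ` sc_cores (2 * n) = dr_cores (2 * n + 2)" .
  qed
  fix c assume c: "c \<in> sc_cores (2 * n)"
  have p: "is_partition c" "conjugate c = c" using c core_partition by (auto simp: sc_cores_def)
  show "lift_core n c \<in> dd_cores (2 * n + 2)"
    unfolding lift_core_eq[OF c n] dd_cores_def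
    using doubled_stretched_core[OF c n] stretched_distinct[OF p(1)] by blast
  show "\<exists>lam\<in>dr_cores (2 * n + 2). lift_core n c = doubled lam"
    using lift_core_eq[OF c n] stretched_dr_core[OF c n] by blast
  show "L_D n c = int (sum_list (distinct_of_core n c))"
    unfolding L_D_eq[OF c assms] sum_residue_counts[OF p n] distinct_of_core_eq[OF c n]
      sum_list_stretched[OF p(1)] by simp
qed

end
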